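(* Let $\mathcal{K}$ be a finite nonempty set of nonnegative $N\times N$ matrices that satisfies the product property and all of whose members have positive spectral radius. Let $f_{\mathcal{K}}(v)=\min_{A\in\mathcal{K}}Av$, and let $\lambda$ be the spectral radius of a $\preceq$-minimal matrix for $\mathcal{K}$. Then the following conditions are equivalent (where in b), c), d) the versions with "some" and with "every" are all equivalent to one another): a) The function $f_{\mathcal{K}}$ has a strictly positive eigenvector, i.e. there are $v>0$ and a scalar $\mu$ with $f_{\mathcal{K}}(v)=\mu v$. b) Some (every) $\preceq$-minimal matrix for $\mathcal{K}$ has a strictly positive eigenvector. c) $(f_{\mathcal{K}}^n(v))_i\sim\lambda^n$ for all $i\in\{1,\ldots,N\}$ and for some (every) vector $v>0$. d) $(f_{\mathcal{K}}^n(v))_i\sim (f_{\mathcal{K}}^n(v))_j$ for all $i,j\in\{1,\ldots,N\}$ and for some (every) vector $v>0$.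
   Context: All vector inequalities and minima of vectors are component-wise; a vector $v$ is strictly positive ($v>0$) if all its components are positive. $f_{\mathcal{K}}^n$ denotes the $n$-fold iterate of $f_{\mathcal{K}}$. Product property: $\mathcal{K}$ satisfies the product property if for every $V\subseteq \{1,\ldots,N\}$ and all $A,B\in\mathcal{K}$, the matrix whose $i$th row is the $i$th row of $A$ for $i\in V$ and the $i$th row of $B$ for $i\notin V$ belongs to $\mathcal{K}$. Growth: for sequences $a_n,b_n$ of nonnegative numbers (or nonnegative vectors of the same dimension), $a_n\preceq b_n$ means that there is a constant $q>0$ with $a_n\le q\,b_n$ for all $n$ large enough; $a_n\sim b_n$ means $a_n\preceq b_n$ and $b_n\preceq a_n$. $\preceq$-minimal: $B\in\mathcal{K}$ is $\preceq$-minimal for $\mathcal{K}$ if $B^nv\preceq A^nv$ for all $A\in\mathcal{K}$ and all $v>0$. Such matrices exist, and all of them have the same spectral radius, so $\lambda$ is well defined. *)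

theory Defs
  imports "Jordan_Normal_Form.Spectral_Radius"
begin

(* Row and column indices 1, ..., N of the mathematics are 0, ..., N - 1 here.  Vectors of
   dimension N are the elements of carrier_vec N. *)

definition product_property :: "nat \<Rightarrow> real mat set \<Rightarrow> bool" where
  "product_property N K \<longleftrightarrow>
     (\<forall>V \<subseteq> {0..<N}. \<forall>A\<in>K. \<forall>B\<in>K. mat N N (\<lambda>(i, j). if i \<in> V then A $$ (i, j) else B $$ (i, j)) \<in> K)"

(* The library order "<" on vectors is the strict part of the componentwise "\<le>", so "0 < v"
   in that sense would only ask for some positive component. *)
definition pos_vec :: "nat \<Rightarrow> real vec \<Rightarrow> bool" where
  "pos_vec N v \<longleftrightarrow> v \<in> carrier_vec N \<and> (\<forall>i<N. 0 < v $ i)"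

definition f_min :: "nat \<Rightarrow> real mat set \<Rightarrow> real vec \<Rightarrow> real vec" where
  "f_min N K v = vec N (\<lambda>i. Min ((\<lambda>A. (A *\<^sub>v v) $ i) ` K))"

definition growth_le :: "(nat \<Rightarrow> real) \<Rightarrow> (nat \<Rightarrow> real) \<Rightarrow> bool" where
  "growth_le a b \<longleftrightarrow> (\<exists>q>0. \<forall>\<^sub>F n in sequentially. a n \<le> q * b n)"

definition growth_eq :: "(nat \<Rightarrow> real) \<Rightarrow> (nat \<Rightarrow> real) \<Rightarrow> bool" where
  "growth_eq a b \<longleftrightarrow> growth_le a b \<and> growth_le b a"

(* "\<le>" on vectors is the componentwise order; one constant q serves all components. *)
definition vec_growth_le :: "(nat \<Rightarrow> real vec) \<Rightarrow> (nat \<Rightarrow> real vec) \<Rightarrow> bool" where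
  "vec_growth_le a b \<longleftrightarrow> (\<exists>q>0. \<forall>\<^sub>F n in sequentially. a n \<le> q \<cdot>\<^sub>v b n)"

definition growth_minimal :: "nat \<Rightarrow> real mat set \<Rightarrow> real mat \<Rightarrow> bool" where
  "growth_minimal N K B \<longleftrightarrow> B \<in> K \<and>
     (\<forall>A\<in>K. \<forall>v. pos_vec N v \<longrightarrow> vec_growth_le (\<lambda>n. (B ^\<^sub>m n) *\<^sub>v v) (\<lambda>n. (A ^\<^sub>m n) *\<^sub>v v))"

definition real_spectral_radius :: "real mat \<Rightarrow> real" where
  "real_spectral_radius A = spectral_radius (map_mat complex_of_real A)"

(* The common spectral radius of the minimal matrices.  That a minimal matrix exists and that
   all of them have the same spectral radius is not built into the definition: without it
   nothing is known about the value. *)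
definition minimal_radius :: "nat \<Rightarrow> real mat set \<Rightarrow> real" where
  "minimal_radius N K = (THE r. \<exists>B. growth_minimal N K B \<and> r = real_spectral_radius B)"

definition has_pos_eigenvector :: "nat \<Rightarrow> real mat \<Rightarrow> bool" where
  "has_pos_eigenvector N B \<longleftrightarrow> (\<exists>v \<mu>. pos_vec N v \<and> eigenvector B v \<mu>)"

end

theory Submission
  imports Defs
begin

text \<open>
  Let \<open>F = f\<^sub>K\<close>. If \<open>F x = \<mu> x\<close> with \<open>x > 0\<close>, the matrix attaining the minimum at \<open>x\<close> is minimal, every orbit of
  \<open>F\<close> grows like \<open>\<mu>\<^sup>n\<close>, and a minimal \<open>B\<close> has \<open>\<mu>\<^sup>n x \<le> B\<^sup>n x \<preceq> \<mu>\<^sup>n x\<close>. A positive eigenvector of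
  \<open>F\<close> (or of the one-element family \<open>{B}\<close>) comes back from two-sided bounds
  \<open>c r\<^sup>n \<le> F\<^sup>n 1 \<le> C r\<^sup>n\<close>: the lower limit \<open>z\<close> of \<open>F\<^sup>n 1 / r\<^sup>n\<close> satisfies \<open>F z \<le> r z\<close>, so
  \<open>F\<^sup>n z / r\<^sup>n\<close> decreases to an eigenvector. If all components of \<open>F\<^sup>n 1\<close> are comparable, such bounds
  hold because \<open>F\<^sup>n 1\<close> is multiplicative in \<open>n\<close> up to a constant; it never vanishes, as otherwise greedy
  rows would form a nilpotent member of the family.

  Existence of a minimal matrix rests on comparing growth rates: the Jordan normal form and
  nonnegativity make each component of \<open>A\<^sup>n 1\<close> eventually \<open>0\<close> or of exact order \<open>n\<^sup>d r\<^sup>n\<close>, so of two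
  components one is \<open>\<preceq>\<close> the other or the other is negligible against it, and rows of two matrices
  can be mixed accordingly.
\<close>

section \<open>Growth of binomial-exponential sums\<close>

text \<open>The hardest implication leads from a positive eigenvector of a minimal \<open>B\<close>
  to one of \<open>F\<close>. Minimality compares \<open>B\<close> with the powers of one member at
  a time, whereas \<open>F\<close> may switch members at every step, so lower bounds on all
  \<open>A^n v\<close> say nothing directly about \<open>F^n v\<close>. The product property closes
  this gap: rows that are optimal at different times can be frozen into one member, and its powers
  are subject to minimality. Existence of a minimal matrix matters even for c), since
  \<open>minimal_radius\<close> is a definite description. The obstacle there is oscillation:
  several eigenvalues of the same modulus could make two components incomparable, as with
  \<open>1 + (-1)^n\<close> and \<open>1 - (-1)^n\<close>. Nonnegativity alone does not prevent
  this. Orbits that start in a strictly positive vector satisfy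
  \<open>a (Suc n) \<le> C * a n\<close>, and this bound does.\<close>

definition power_exp_growth :: "(nat \<Rightarrow> real) \<Rightarrow> bool" where
  "power_exp_growth a \<longleftrightarrow> (\<forall>\<^sub>F n in sequentially. a n = 0) \<or>
     (\<exists>r>0. \<exists>d. \<exists>c>0. \<exists>C>0. \<forall>\<^sub>F n in sequentially.
        c * (real n ^ d * r ^ n) \<le> a n \<and> a n \<le> C * (real n ^ d * r ^ n))"

section \<open>Asymptotics of single binomial-exponential terms\<close>

lemma null_comparison:
  fixes f :: "'a \<Rightarrow> 'b::real_normed_vector"
  assumes "\<forall>\<^sub>F x in F. norm (f x) \<le> g x" "(g \<longlongrightarrow> 0) F"
  shows "(f \<longlongrightarrow> 0) F"
  using assms(2)
  by (rule tendsto_0_le[where K = 1])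
    (use assms(1) in \<open>auto elim!: eventually_mono intro: order_trans\<close>)

lemma binomial_over_power_tendsto:
  "(\<lambda>n. real (n choose k) / real n ^ k) \<longlonglongrightarrow> 1 / fact k"
proof (induction k)
  case 0
  then show ?case by simp
next
  case (Suc k)
  have l: "(\<lambda>n. 1 - real k / real n) \<longlonglongrightarrow> 1 - 0"
    by (intro tendsto_intros lim_const_over_n)
  have "(\<lambda>n. real (n choose k) / real n ^ k * (1 - real k / real n) / real (Suc k))
          \<longlonglongrightarrow> 1 / fact k * (1 - 0) / real (Suc k)"
    by (intro tendsto_intros Suc l) simp
  moreover have "\<forall>\<^sub>F n in sequentially. real (n choose k) / real n ^ k * (1 - real k / real n) / real (Suc k)
      = real (n choose Suc k) / real n ^ Suc k"
    using eventually_gt_at_top[of "max 1 k"]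
  proof eventually_elim
    case (elim n)
    have "Suc k * (n choose Suc k) = (n - k) * (n choose k)"
      by (metis binomial_absorb_comp binomial_absorption mult.commute)
    then have "real (Suc k) * real (n choose Suc k) = real (n - k) * real (n choose k)"
      by (metis of_nat_mult)
    then have *: "real (n choose Suc k) = (real n - real k) * real (n choose k) / real (Suc k)"
      using elim by (simp add: field_simps of_nat_diff)
    show ?case unfolding * using elim by (simp add: field_simps)
  qed
  ultimately show ?case
    by (rule Lim_transform_eventually[THEN tendsto_eq_rhs]) (simp add: field_simps)
qed

lemma power_times_geometric_tendsto_0:
  fixes x :: real
  assumes "0 \<le> x" "x < 1"
  shows "(\<lambda>n. real n ^ k * x ^ n) \<longlonglongrightarrow> 0"
proof (cases "k = 0 \<or> x = 0")
  case True
  then show ?thesis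
  proof
    assume "k = 0"
    then show ?thesis using LIMSEQ_realpow_zero[OF assms] by simp
  next
    assume "x = 0"
    then have "\<forall>\<^sub>F n in sequentially. real n ^ k * x ^ n = 0"
      by (intro eventually_sequentiallyI[of 1]) simp
    then show ?thesis by (rule tendsto_eventually)
  qed
next
  case False
  \<comment> \<open>With a \<open>k\<close>-th root, \<open>n^k x^n = (n y^n)^k\<close>, which
    reduces the claim to exponent 1.\<close>
  define y where "y = root k x"
  have y: "0 < y" "y < 1" "y ^ k = x"
    using False assms by (auto simp: y_def)
  have "(\<lambda>n. of_nat n / (1 / y) ^ n) \<longlonglongrightarrow> 0"
    by (rule lim_n_over_pown) (use y in simp)
  then have "(\<lambda>n. (real n * y ^ n) ^ k) \<longlonglongrightarrow> 0 ^ k"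
    by (intro tendsto_power) (simp add: field_simps)
  moreover have "(real n * y ^ n) ^ k = real n ^ k * x ^ n" for n
    by (simp add: power_mult_distrib y(3)[symmetric] mult.commute flip: power_mult)
  ultimately show ?thesis using False by (simp add: power_0_left)
qed

lemma power_exp_ratio_tendsto_0:
  fixes r s :: real
  assumes "r > 0" "s \<ge> 0" and "s < r \<or> (s = r \<and> k < d)"
  shows "(\<lambda>n. real n ^ k / real n ^ d * (s / r) ^ n) \<longlonglongrightarrow> 0"
  using assms(3)
proof
  assume *: "s < r"
  have "(\<lambda>n. real n ^ k * (s / r) ^ n) \<longlonglongrightarrow> 0"
    by (rule power_times_geometric_tendsto_0) (use * assms in auto)
  then show ?thesis
  proof (rule null_comparison[rotated])
    show "\<forall>\<^sub>F n in sequentially. norm (real n ^ k / real n ^ d * (s / r) ^ n)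
       \<le> real n ^ k * (s / r) ^ n"
      using eventually_gt_at_top[of 0]
    proof eventually_elim
      case (elim n)
      have "real n ^ k / real n ^ d \<le> real n ^ k / 1"
        using elim by (intro divide_left_mono) auto
      then have "real n ^ k / real n ^ d * (s / r) ^ n \<le> real n ^ k * (s / r) ^ n"
        using assms by (intro mult_right_mono) auto
      then show ?case using assms by simp
    qed
  qed
next
  assume *: "s = r \<and> k < d"
  have "(\<lambda>n. (1 / real n) ^ (d - k)) \<longlonglongrightarrow> 0 ^ (d - k)"
    by (intro tendsto_power lim_1_over_n)
  moreover have "\<forall>\<^sub>F n in sequentially. (1 / real n) ^ (d - k)
      = real n ^ k / real n ^ d * (s / r) ^ n"
    using eventually_gt_at_top[of 0]
  proof eventually_elim
    case (elim n)
    then show ?case using * assms(1) by (simp add: power_diff power_one_over field_simps)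
  qed
  ultimately show ?thesis
    using * by (simp add: power_0_left filterlim_cong)
qed

lemma binomial_exp_term_negligible:
  fixes l :: complex and r :: real
  assumes "r > 0" and "norm l < r \<or> (norm l = r \<and> k < d)"
  shows "(\<lambda>n. of_nat (n choose k) * l ^ n / of_real (real n ^ d * r ^ n)) \<longlonglongrightarrow> 0"
proof -
  have b: "(\<lambda>n. real (n choose k) / real n ^ k) \<longlonglongrightarrow> 1 / fact k"
    by (rule binomial_over_power_tendsto)
  have "(\<lambda>n. real n ^ k / real n ^ d * (norm l / r) ^ n) \<longlonglongrightarrow> 0"
    by (rule power_exp_ratio_tendsto_0) (use assms in auto)
  from tendsto_mult[OF b this]
  have "(\<lambda>n. real (n choose k) / real n ^ k * (real n ^ k / real n ^ d * (norm l / r) ^ n)) \<longlonglongrightarrow> 0"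
    by simp
  then show ?thesis
  proof (rule null_comparison[rotated])
    show "\<forall>\<^sub>F n in sequentially. norm (of_nat (n choose k) * l ^ n / of_real (real n ^ d * r ^ n))
       \<le> real (n choose k) / real n ^ k * (real n ^ k / real n ^ d * (norm l / r) ^ n)"
      using eventually_gt_at_top[of 0]
    proof eventually_elim
      case (elim n)
      then show ?case using assms(1)
        by (simp add: norm_mult norm_divide norm_power power_divide)
    qed
  qed
qed

text \<open>A term of exact leading order does not converge after division: it approaches a rotation
  on a circle. Hence the limit is stated for a difference.\<close>

lemma binomial_exp_term_leading:
  fixes l :: complex and r :: real
  assumes "r > 0" and "norm l = r"
  shows "(\<lambda>n. of_nat (n choose d) * l ^ n / of_real (real n ^ d * r ^ n)
            - (l / of_real r) ^ n / fact d) \<longlonglongrightarrow> 0"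
proof -
  have "(\<lambda>n. real (n choose d) / real n ^ d - 1 / fact d) \<longlonglongrightarrow> 1 / fact d - 1 / fact d"
    by (intro tendsto_intros binomial_over_power_tendsto)
  then have "(\<lambda>n. \<bar>real (n choose d) / real n ^ d - 1 / fact d\<bar>) \<longlonglongrightarrow> 0"
    by (simp add: tendsto_rabs_zero_iff)
  then show ?thesis
  proof (rule null_comparison[rotated])
    show "\<forall>\<^sub>F n in sequentially. norm (of_nat (n choose d) * l ^ n / of_real (real n ^ d * r ^ n)
            - (l / of_real r) ^ n / fact d) \<le> \<bar>real (n choose d) / real n ^ d - 1 / fact d\<bar>"
    proof (rule always_eventually, rule allI)
      fix n
      have "of_nat (n choose d) * l ^ n / of_real (real n ^ d * r ^ n) - (l / of_real r) ^ n / fact d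
          = of_real (real (n choose d) / real n ^ d - 1 / fact d) * (l / of_real r) ^ n"
      proof -
        have "x * y / (u * v) - y / v / f = (x / u - 1 / f) * (y / v)" for x y u v f :: complex
          by (simp add: divide_inverse algebra_simps)
        then show ?thesis by (simp add: power_divide)
      qed
      moreover have "norm ((l / of_real r) ^ n) = 1"
        using assms by (simp add: norm_power norm_divide)
      ultimately show "norm (of_nat (n choose d) * l ^ n / of_real (real n ^ d * r ^ n)
            - (l / of_real r) ^ n / fact d) \<le> \<bar>real (n choose d) / real n ^ d - 1 / fact d\<bar>"
        by (simp only: norm_mult norm_of_real mult_1_right order_refl)
    qed
  qed
qed

text \<open>Divided by its leading order, the sum approaches a finite combination of rotations,
  which is bounded but may come close to 0 again and again. The hypothesis on
  \<open>a (Suc n)\<close> excludes examples like \<open>1 + (-1)^n\<close>: a small value would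
  keep the next few values small as well.\<close>

lemma power_exp_growth_of_binomial_exp_sum:
  fixes a :: "nat \<Rightarrow> real" and F :: "(complex \<times> nat) set"
  assumes F: "finite F" "\<forall>p\<in>F. fst p \<noteq> 0"
    and a: "\<forall>\<^sub>F n in sequentially.
          complex_of_real (a n) = (\<Sum>p\<in>F. c p * (of_nat (n choose snd p) * fst p ^ n))"
    and nonneg: "\<And>n. a n \<ge> 0" and C: "C > 0" "\<And>n. a (Suc n) \<le> C * a n"
  shows "power_exp_growth a"
proof -
  \<comment> \<open>Zero coefficients are discarded, so that the maxima \<open>r\<close> and
    \<open>d\<close> are taken over terms that really occur.\<close>
  define G where "G = {p\<in>F. c p \<noteq> 0}"
  have G: "finite G" "\<And>p. p \<in> G \<Longrightarrow> fst p \<noteq> 0" "\<And>p. p \<in> G \<Longrightarrow> c p \<noteq> 0"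
    using F by (auto simp: G_def)
  have aG: "\<forall>\<^sub>F n in sequentially.
          complex_of_real (a n) = (\<Sum>p\<in>G. c p * (of_nat (n choose snd p) * fst p ^ n))"
    using a
  proof eventually_elim
    case (elim n)
    have "(\<Sum>p\<in>G. c p * (of_nat (n choose snd p) * fst p ^ n)) =
          (\<Sum>p\<in>F. c p * (of_nat (n choose snd p) * fst p ^ n))"
      by (rule sum.mono_neutral_left) (use F in \<open>auto simp: G_def\<close>)
    then show ?case using elim by simp
  qed
  show ?thesis
  proof (cases "G = {}")
    case True
    then show ?thesis using aG by (simp add: power_exp_growth_def)
  next
    case False
    define r where "r = Max ((\<lambda>p. norm (fst p)) ` G)"
    have r_in: "r \<in> (\<lambda>p. norm (fst p)) ` G"
      unfolding r_def using G False by (intro Max_in) auto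
    have r_ge: "norm (fst p) \<le> r" if "p \<in> G" for p
      unfolding r_def using G that by (intro Max_ge) auto
    have r: "r > 0" using r_in G by auto
    define H where "H = {p\<in>G. norm (fst p) = r}"
    have H: "finite H" "H \<noteq> {}" using G r_in by (auto simp: H_def)
    define d where "d = Max (snd ` H)"
    have d_in: "d \<in> snd ` H" unfolding d_def using H by (intro Max_in) auto
    have d_ge: "snd p \<le> d" if "p \<in> H" for p
      unfolding d_def using H that by (intro Max_ge) auto
    \<comment> \<open>The leading terms all share the degree \<open>d\<close>, so distinct elements
      of \<open>T\<close> have distinct frequencies; the interpolation by \<open>q\<close> relies on
      this.\<close>
    define T where "T = {p\<in>H. snd p = d}"
    have T: "finite T" "T \<subseteq> G" "T \<noteq> {}" using H d_in by (auto simp: T_def) (auto simp: H_def)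
    define e where "e n = real n ^ d * r ^ n" for n
    define z where "z n = a n / e n" for n
    define \<theta> where "\<theta> p = fst p / complex_of_real r" for p :: "complex \<times> nat"
    have \<theta>1: "norm (\<theta> p) = 1" if "p \<in> T" for p
      using that r by (auto simp: \<theta>_def T_def H_def norm_divide)
    define P where "P n = (\<Sum>p\<in>T. c p * (\<theta> p ^ n / fact d))" for n
    have lim1: "(\<lambda>n. (\<Sum>p\<in>G. c p * (of_nat (n choose snd p) * fst p ^ n / of_real (e n)
         - (if p \<in> T then \<theta> p ^ n / fact d else 0)))) \<longlonglongrightarrow> (\<Sum>p\<in>G. c p * 0)"
    proof (intro tendsto_sum tendsto_mult tendsto_const)
      fix p assume p: "p \<in> G"
      show "(\<lambda>n. of_nat (n choose snd p) * fst p ^ n / of_real (e n)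
         - (if p \<in> T then \<theta> p ^ n / fact d else 0)) \<longlonglongrightarrow> 0"
      proof (cases "p \<in> T")
        case True
        then show ?thesis using binomial_exp_term_leading[OF r, of "fst p" d]
          by (auto simp: e_def \<theta>_def T_def H_def)
      next
        case False
        then have "norm (fst p) < r \<or> (norm (fst p) = r \<and> snd p < d)"
          using r_ge[OF p] d_ge[of p] p by (force simp: T_def H_def)
        then show ?thesis using binomial_exp_term_negligible[OF r] False
          by (auto simp: e_def)
      qed
    qed
    have "\<forall>\<^sub>F n in sequentially. (\<Sum>p\<in>G. c p * (of_nat (n choose snd p) * fst p ^ n / of_real (e n)
         - (if p \<in> T then \<theta> p ^ n / fact d else 0))) = complex_of_real (z n) - P n"
      using aG
    proof eventually_elim
      case (elim n)
      have "(\<Sum>p\<in>G. c p * (if p \<in> T then \<theta> p ^ n / fact d else 0)) = P n"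
        unfolding P_def by (rule sum.mono_neutral_cong_right) (use G T in auto)
      moreover have "(\<Sum>p\<in>G. c p * (of_nat (n choose snd p) * fst p ^ n / of_real (e n)))
          = complex_of_real (z n)"
        unfolding z_def of_real_divide elim sum_divide_distrib by simp
      ultimately show ?case by (simp add: algebra_simps sum_subtractf)
    qed
    with lim1 have lim: "(\<lambda>n. complex_of_real (z n) - P n) \<longlonglongrightarrow> 0"
      using Lim_transform_eventually by fastforce
    have z_nonneg: "z n \<ge> 0" for n using nonneg r by (simp add: z_def e_def)
    define B where "B = (\<Sum>p\<in>T. norm (c p))"
    have PB: "norm (P n) \<le> B" for n
      unfolding P_def B_def
    proof (rule sum_norm_le)
      fix p assume p: "p \<in> T"
      have "norm (c p * (\<theta> p ^ n / fact d)) = norm (c p) / fact d"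
        by (simp add: norm_mult norm_divide norm_power \<theta>1[OF p])
      also have "\<dots> \<le> norm (c p) / 1" by (rule divide_left_mono) (auto simp: fact_ge_1)
      finally show "norm (c p * (\<theta> p ^ n / fact d)) \<le> norm (c p)" by simp
    qed
    have B0: "B \<ge> 0" by (simp add: B_def sum_nonneg)
    have close1: "\<forall>\<^sub>F n in sequentially. dist (complex_of_real (z n) - P n) 0 < 1"
      by (rule tendstoD[OF lim]) simp
    have upper: "\<forall>\<^sub>F n in sequentially. a n \<le> (B + 1) * e n"
      using close1 eventually_gt_at_top[of 0]
    proof eventually_elim
      case (elim n)
      have "norm (complex_of_real (z n)) \<le> norm (complex_of_real (z n) - P n) + norm (P n)"
        using norm_triangle_ineq[of "complex_of_real (z n) - P n" "P n"] by simp
      then have "z n \<le> B + 1" using elim PB[of n] z_nonneg[of n] by (simp add: dist_norm)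
      moreover have "e n > 0" using elim r by (simp add: e_def)
      ultimately show ?case by (simp add: z_def field_simps)
    qed
    obtain t where t: "t \<in> T" using T by auto
    \<comment> \<open>Applied to the shifts of the leading part \<open>P\<close>, the polynomial \<open>q\<close> kills all frequencies but
      \<open>\<theta> t\<close>, so \<open>P\<close> cannot be small at all of \<open>n, \<dots>, n + degree q\<close>; the hypothesis on
      \<open>a (Suc n)\<close> carries the lower bound back to \<open>n\<close>.\<close>
    define q where "q = (\<Prod>p\<in>T - {t}. [:- \<theta> p, 1:])"
    have inj: "\<theta> p \<noteq> \<theta> t" if "p \<in> T - {t}" for p
      using that t r by (auto simp: T_def \<theta>_def prod_eq_iff)
    have q0: "poly q (\<theta> p) = 0" if "p \<in> T - {t}" for p
      using that T by (auto simp: q_def poly_prod)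
    have qt: "poly q (\<theta> t) \<noteq> 0"
    proof -
      have "poly [:- \<theta> p, 1:] (\<theta> t) \<noteq> 0" if "p \<in> T - {t}" for p
        using inj[OF that] by simp
      then show ?thesis
        unfolding q_def poly_prod using T by (subst prod_zero_iff) auto
    qed
    define \<kappa> where "\<kappa> = norm (c t) / fact d * norm (poly q (\<theta> t))"
    have \<kappa>: "\<kappa> > 0" using qt G(3)[of t] t T by (auto simp: \<kappa>_def)
    have filter: "(\<Sum>j\<le>degree q. coeff q j * P (n + j)) = c t * (\<theta> t ^ n / fact d) * poly q (\<theta> t)" for n
    proof -
      have "(\<Sum>j\<le>degree q. coeff q j * P (n + j))
          = (\<Sum>j\<le>degree q. \<Sum>p\<in>T. coeff q j * (c p * (\<theta> p ^ (n + j) / fact d)))"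
        by (simp add: P_def sum_distrib_left)
      also have "\<dots> = (\<Sum>p\<in>T. \<Sum>j\<le>degree q. coeff q j * (c p * (\<theta> p ^ (n + j) / fact d)))"
        by (rule sum.swap)
      also have "\<dots> = (\<Sum>p\<in>T. c p * (\<theta> p ^ n / fact d) * poly q (\<theta> p))"
        by (intro sum.cong refl) (simp add: poly_altdef sum_distrib_left power_add algebra_simps)
      also have "\<dots> = (\<Sum>p\<in>{t}. c p * (\<theta> p ^ n / fact d) * poly q (\<theta> p))"
        by (rule sum.mono_neutral_right) (use T t q0 in auto)
      finally show ?thesis by simp
    qed
    have "(\<lambda>n. \<Sum>j\<le>degree q. coeff q j * (complex_of_real (z (n + j)) - P (n + j)))
        \<longlonglongrightarrow> (\<Sum>j\<le>degree q. coeff q j * 0)"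
      by (intro tendsto_sum tendsto_mult tendsto_const LIMSEQ_ignore_initial_segment lim)
    then have lim2: "(\<lambda>n. \<Sum>j\<le>degree q. coeff q j * (complex_of_real (z (n + j)) - P (n + j))) \<longlonglongrightarrow> 0"
      by simp
    \<comment> \<open>\<open>z (n + j)\<close> is at most \<open>(C / r)^j * z n\<close>, so
      \<open>D\<close> bounds the effect of the filter \<open>q\<close> on \<open>z\<close> in terms
      of \<open>z n\<close> alone. Later \<open>D + 1\<close> replaces \<open>D\<close> to have a
      positive denominator.\<close>
    define D where "D = (\<Sum>j\<le>degree q. norm (coeff q j) * (C / r) ^ j)"
    have D0: "D \<ge> 0" using C r by (simp add: D_def sum_nonneg)
    have aC: "a (n + j) \<le> C ^ j * a n" for n j
    proof (induction j)
      case (Suc j)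
      have "a (n + Suc j) \<le> C * a (n + j)" using C by simp
      also have "\<dots> \<le> C * (C ^ j * a n)" using Suc C by (intro mult_left_mono) auto
      finally show ?case by simp
    qed simp
    have lower: "\<forall>\<^sub>F n in sequentially. \<kappa> / 2 / (D + 1) * e n \<le> a n"
      using tendstoD[OF lim2 half_gt_zero[OF \<kappa>]] eventually_gt_at_top[of 0]
    proof eventually_elim
      case (elim n)
      have en: "e n > 0" using elim r by (simp add: e_def)
      define S where "S = (\<Sum>j\<le>degree q. coeff q j * complex_of_real (z (n + j)))"
      have "(\<Sum>j\<le>degree q. coeff q j * (complex_of_real (z (n + j)) - P (n + j)))
          = S - c t * (\<theta> t ^ n / fact d) * poly q (\<theta> t)"
        by (simp add: S_def right_diff_distrib sum_subtractf filter)
      with elim have "norm (S - c t * (\<theta> t ^ n / fact d) * poly q (\<theta> t)) < \<kappa> / 2"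
        using \<kappa> by simp
      moreover have "norm (c t * (\<theta> t ^ n / fact d) * poly q (\<theta> t)) = \<kappa>"
        by (simp add: \<kappa>_def norm_mult norm_divide norm_power \<theta>1[OF t])
      ultimately have "\<kappa> / 2 \<le> norm S"
        using norm_triangle_ineq2[of "c t * (\<theta> t ^ n / fact d) * poly q (\<theta> t)" S]
        by (simp add: norm_minus_commute)
      also have "norm S \<le> (\<Sum>j\<le>degree q. norm (coeff q j) * ((C / r) ^ j * z n))"
        unfolding S_def
      proof (rule sum_norm_le)
        fix j
        have "z (n + j) \<le> C ^ j * a n / (e n * r ^ j)"
          unfolding z_def
        proof (rule frac_le)
          have "real n ^ d \<le> real (n + j) ^ d" by (rule power_mono) auto
          then show "e n * r ^ j \<le> e (n + j)"
            using r unfolding e_def power_add by (simp add: mult_right_mono)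
        qed (use aC en r C nonneg in auto)
        also have "\<dots> = (C / r) ^ j * z n"
          by (simp add: z_def power_divide)
        finally show "norm (coeff q j * complex_of_real (z (n + j)))
              \<le> norm (coeff q j) * ((C / r) ^ j * z n)"
          using z_nonneg by (simp add: norm_mult mult_left_mono)
      qed
      also have "\<dots> = D * z n" by (simp add: D_def sum_distrib_right mult.assoc)
      also have "\<dots> \<le> (D + 1) * z n" using z_nonneg by (intro mult_right_mono) auto
      finally have "\<kappa> / 2 \<le> (D + 1) * (a n / e n)" by (simp add: z_def)
      then show ?case using D0 en by (simp add: field_simps)
    qed
    show ?thesis
      unfolding power_exp_growth_def
      apply (rule disjI2, rule exI[of _ r], intro conjI r, rule exI[of _ d])
      apply (rule exI[of _ "\<kappa> / 2 / (D + 1)"], intro conjI)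
      subgoal using \<kappa> D0 by simp
      apply (rule exI[of _ "B + 1"], intro conjI)
      subgoal using B0 by simp
      using upper lower by eventually_elim (auto simp: e_def)
  qed
qed

section \<open>Entries of matrix powers as binomial-exponential sums\<close>

definition binomial_exp_sum :: "(nat \<Rightarrow> complex) \<Rightarrow> bool" where
  "binomial_exp_sum s \<longleftrightarrow> (\<exists>(F :: (complex \<times> nat) set) c. finite F \<and> (\<forall>p\<in>F. fst p \<noteq> 0) \<and>
     (\<forall>\<^sub>F n in sequentially. s n = (\<Sum>p\<in>F. c p * (of_nat (n choose snd p) * fst p ^ n))))"

text \<open>Covers Jordan blocks for the eigenvalue 0, whose powers vanish from some exponent on.
  This is why frequencies can be required to be nonzero and equality only eventually.\<close>

lemma binomial_exp_sum_eventually_0: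
  "\<forall>\<^sub>F n in sequentially. s n = 0 \<Longrightarrow> binomial_exp_sum s"
  unfolding binomial_exp_sum_def by (rule exI[of _ "{}"]) simp

lemma binomial_exp_sum_cmult:
  assumes "binomial_exp_sum s"
  shows "binomial_exp_sum (\<lambda>n. k * s n)"
proof -
  obtain F c where "finite F" "\<forall>p\<in>F. fst p \<noteq> 0"
    and s: "\<forall>\<^sub>F n in sequentially. s n = (\<Sum>p\<in>F. c p * (of_nat (n choose snd p) * fst p ^ n))"
    using assms unfolding binomial_exp_sum_def by blast
  moreover have "\<forall>\<^sub>F n in sequentially. k * s n = (\<Sum>p\<in>F. (k * c p) * (of_nat (n choose snd p) * fst p ^ n))"
    using s by eventually_elim (simp add: sum_distrib_left mult.assoc)
  ultimately show ?thesis unfolding binomial_exp_sum_def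
    by (intro exI[of _ F] exI[of _ "\<lambda>p. k * c p"]) simp
qed

lemma binomial_exp_sum_add:
  assumes "binomial_exp_sum s" "binomial_exp_sum t"
  shows "binomial_exp_sum (\<lambda>n. s n + t n)"
proof -
  obtain F c where F: "finite F" "\<forall>p\<in>F. fst p \<noteq> 0"
    and s: "\<forall>\<^sub>F n in sequentially. s n = (\<Sum>p\<in>F. c p * (of_nat (n choose snd p) * fst p ^ n))"
    using assms(1) unfolding binomial_exp_sum_def by blast
  obtain G b where G: "finite G" "\<forall>p\<in>G. fst p \<noteq> 0"
    and t: "\<forall>\<^sub>F n in sequentially. t n = (\<Sum>p\<in>G. b p * (of_nat (n choose snd p) * fst p ^ n))"
    using assms(2) unfolding binomial_exp_sum_def by blast
  define e where "e p = (if p \<in> F then c p else 0) + (if p \<in> G then b p else 0)" for p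
  have "\<forall>\<^sub>F n in sequentially. s n + t n = (\<Sum>p\<in>F \<union> G. e p * (of_nat (n choose snd p) * fst p ^ n))"
    using s t
  proof eventually_elim
    case (elim n)
    have 1: "(\<Sum>p\<in>F \<union> G. (if p \<in> F then c p else 0) * (of_nat (n choose snd p) * fst p ^ n))
        = (\<Sum>p\<in>F. c p * (of_nat (n choose snd p) * fst p ^ n))"
      by (rule sum.mono_neutral_cong_right) (use F G in auto)
    have 2: "(\<Sum>p\<in>F \<union> G. (if p \<in> G then b p else 0) * (of_nat (n choose snd p) * fst p ^ n))
        = (\<Sum>p\<in>G. b p * (of_nat (n choose snd p) * fst p ^ n))"
      by (rule sum.mono_neutral_cong_right) (use F G in auto)
    show ?case unfolding elim e_def distrib_right sum.distrib 1 2 ..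
  qed
  then show ?thesis unfolding binomial_exp_sum_def
    using F G by (intro exI[of _ "F \<union> G"] exI[of _ e]) auto
qed

lemma binomial_exp_sum_sum:
  "(\<And>j. j \<in> J \<Longrightarrow> binomial_exp_sum (s j)) \<Longrightarrow> binomial_exp_sum (\<lambda>n. \<Sum>j\<in>J. s j n)"
  by (induction J rule: infinite_finite_induct)
    (auto intro: binomial_exp_sum_eventually_0 binomial_exp_sum_add)

lemma binomial_exp_sum_jordan_block_pow:
  assumes "i < m" "j < m"
  shows "binomial_exp_sum (\<lambda>n. (jordan_block m a ^\<^sub>m n) $$ (i, j))"
proof (cases "i \<le> j \<and> a \<noteq> 0")
  case True
  \<comment> \<open>The coefficient \<open>inverse (a ^ (j - i))\<close> shifts the exponent
    \<open>n - (j - i)\<close> of the block entry to \<open>n\<close>. For \<open>n < j - i\<close>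
    the binomial coefficient is 0.\<close>
  have "(jordan_block m a ^\<^sub>m n) $$ (i, j) =
      (\<Sum>p\<in>{(a, j - i)}. inverse (a ^ (j - i)) * (of_nat (n choose snd p) * fst p ^ n))" for n
  proof (cases "j - i \<le> n")
    case le: True
    have "a ^ (n + i - j) * a ^ (j - i) = a ^ n"
      using le True by (simp flip: power_add)
    then have "a ^ (n + i - j) = a ^ n * inverse (a ^ (j - i))"
      using True by (simp add: field_simps)
    then show ?thesis using True assms by (simp add: jordan_block_pow)
  qed (use True assms in \<open>simp add: jordan_block_pow\<close>)
  then show ?thesis unfolding binomial_exp_sum_def using True
    by (intro exI[of _ "{(a, j - i)}"] exI[of _ "\<lambda>p. inverse (a ^ (j - i))"]) auto
next
  case False
  \<comment> \<open>On or above the diagonal with \<open>a = 0\<close>, the entry is nonzero only at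
    \<open>n = j - i\<close>, hence never from \<open>Suc j\<close> on.\<close>
  show ?thesis
  proof (intro binomial_exp_sum_eventually_0 eventually_sequentiallyI[of "Suc j"])
    fix n assume "Suc j \<le> n"
    then show "(jordan_block m a ^\<^sub>m n) $$ (i, j) = 0"
      using False assms by (auto simp: jordan_block_pow power_0_left)
  qed
qed

lemma binomial_exp_sum_jordan_matrix_pow:
  assumes "i < sum_list (map fst n_as)" "j < sum_list (map fst n_as)"
  shows "binomial_exp_sum (\<lambda>n. (jordan_matrix n_as ^\<^sub>m n) $$ (i, j))"
  using assms
proof (induction n_as arbitrary: i j)
  case (Cons p n_as)
  obtain m a where p: "p = (m, a)" by force
  define M where "M = sum_list (map fst n_as)"
  have dim: "dim_row (jordan_matrix n_as ^\<^sub>m n) = M" "dim_col (jordan_matrix n_as ^\<^sub>m n) = M" for n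
    by (simp_all add: M_def pow_mat_dim_square[OF jordan_matrix_carrier])
  have eq: "jordan_matrix (p # n_as) ^\<^sub>m n = four_block_mat (jordan_block m a ^\<^sub>m n) (0\<^sub>m m M)
      (0\<^sub>m M m) (jordan_matrix n_as ^\<^sub>m n)" for n
    using dim[of n] unfolding p jordan_matrix_pow by (simp add: Let_def)
  have ij: "i < m + M" "j < m + M" using Cons.prems by (auto simp: p M_def)
  have entry: "(jordan_matrix (p # n_as) ^\<^sub>m n) $$ (i, j) =
      (if i < m then if j < m then (jordan_block m a ^\<^sub>m n) $$ (i, j) else 0
       else if j < m then 0 else (jordan_matrix n_as ^\<^sub>m n) $$ (i - m, j - m))" for n
    unfolding eq using ij by (auto simp: M_def)
  show ?case unfolding entry
    using Cons.IH[of "i - m" "j - m"] binomial_exp_sum_jordan_block_pow[of i m j a] ij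
    by (cases "i < m"; cases "j < m") (auto simp: M_def intro: binomial_exp_sum_eventually_0)
qed simp

text \<open>Conjugation to Jordan form makes each entry of the power a linear combination of entries
  of the power of \<open>J\<close>, with coefficients independent of \<open>n\<close>.\<close>

lemma binomial_exp_sum_pow_mat:
  fixes A :: "complex mat"
  assumes A: "A \<in> carrier_mat N N" and ij: "i < N" "j < N"
  shows "binomial_exp_sum (\<lambda>n. (A ^\<^sub>m n) $$ (i, j))"
proof -
  obtain as where "char_poly A = (\<Prod>a\<leftarrow>as. [:- a, 1:])"
    using char_poly_factorized[OF A] by auto
  then obtain n_as where jnf: "jordan_nf A n_as" using jordan_nf_exists[OF A] by auto
  obtain P Q where PQ: "P \<in> carrier_mat N N" "Q \<in> carrier_mat N N"
    "\<And>n. A ^\<^sub>m n = P * (jordan_matrix n_as) ^\<^sub>m n * Q"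
    using jordan_nf_powE[OF A jnf] by metis
  define J where "J = jordan_matrix n_as"
  have "similar_mat A J" using jnf by (simp add: jordan_nf_def J_def)
  then have J: "J \<in> carrier_mat N N" and N: "sum_list (map fst n_as) = N"
    using A similar_matD[of A J] jordan_matrix_carrier[of n_as] unfolding J_def
    by (metis carrier_matD(1) insert_subset)+
  have "(A ^\<^sub>m n) $$ (i, j) = (\<Sum>k<N. P $$ (i, k) * (\<Sum>l<N. Q $$ (l, j) * (J ^\<^sub>m n) $$ (k, l)))" for n
  proof -
    have Jn: "J ^\<^sub>m n \<in> carrier_mat N N" using J by simp
    have row: "row (J ^\<^sub>m n) k $ l = (J ^\<^sub>m n) $$ (k, l)" if "k < N" "l < N" for k l
      using that carrier_matD[OF Jn] by (simp add: index_row del: pow_mat_dim)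
    show ?thesis
      unfolding PQ(3) J_def[symmetric] using PQ(1,2) Jn ij
      by (auto simp: scalar_prod_def atLeast0LessThan mult.commute row simp del: pow_mat_dim intro!: sum.cong arg_cong2[of _ _ _ _ "(*)"])
  qed
  moreover have "binomial_exp_sum (\<lambda>n. \<Sum>k<N. P $$ (i, k) * (\<Sum>l<N. Q $$ (l, j) * (J ^\<^sub>m n) $$ (k, l)))"
    by (intro binomial_exp_sum_sum binomial_exp_sum_cmult)
      (use N in \<open>auto simp: J_def intro: binomial_exp_sum_jordan_matrix_pow\<close>)
  ultimately show ?thesis by simp
qed

text \<open>Orders \<open>n^d r^n\<close> are compared lexicographically by \<open>(r, d)\<close>,
  and a strictly smaller one is negligible. The second alternative allows every \<open>e > 0\<close>
  because \<open>common_growth_minorant\<close> applies it with the reciprocal of a constant fixed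
  by the first.\<close>

lemma power_exp_growth_dichotomy:
  assumes a: "power_exp_growth a" and b: "power_exp_growth b"
    and nonneg: "\<And>n. a n \<ge> 0" "\<And>n. b n \<ge> 0"
  shows "(\<exists>q>0. \<forall>\<^sub>F n in sequentially. a n \<le> q * b n) \<or>
         (\<forall>e>0. \<forall>\<^sub>F n in sequentially. b n \<le> e * a n)"
proof -
  have cmp: "\<forall>\<^sub>F n in sequentially. real n ^ k * s ^ n \<le> e * (real n ^ d * r ^ n)"
    if "r > 0" "s > 0" "s < r \<or> (s = r \<and> k < d)" "e > 0" for r s e :: real and k d
  proof -
    have "(\<lambda>n. real n ^ k / real n ^ d * (s / r) ^ n) \<longlonglongrightarrow> 0"
      by (rule power_exp_ratio_tendsto_0) (use that in auto)
    from tendstoD[OF this \<open>e > 0\<close>] show ?thesis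
      using eventually_gt_at_top[of 0]
    proof eventually_elim
      case (elim n)
      have "real n ^ k / real n ^ d * (s / r) ^ n < e"
        using elim that by (simp add: dist_norm)
      then show ?case using elim that by (simp add: power_divide field_simps)
    qed
  qed
  show ?thesis
  proof (cases "(\<forall>\<^sub>F n in sequentially. a n = 0) \<or> (\<forall>\<^sub>F n in sequentially. b n = 0)")
    case True
    then show ?thesis
    proof
      assume "\<forall>\<^sub>F n in sequentially. a n = 0"
      then have "\<forall>\<^sub>F n in sequentially. a n \<le> 1 * b n"
        by eventually_elim (use nonneg in auto)
      then show ?thesis by (intro disjI1 exI[of _ 1] conjI) simp_all
    next
      assume b0: "\<forall>\<^sub>F n in sequentially. b n = 0"
      have "\<forall>\<^sub>F n in sequentially. b n \<le> e * a n" if "e > 0" for e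
        using b0 by eventually_elim (use nonneg that in auto)
      then show ?thesis by (intro disjI2 allI impI)
    qed
  next
    case False
    obtain r d c C where r: "r > 0" "c > 0" "C > 0" "\<forall>\<^sub>F n in sequentially.
        c * (real n ^ d * r ^ n) \<le> a n \<and> a n \<le> C * (real n ^ d * r ^ n)"
      using a False unfolding power_exp_growth_def by blast
    obtain s k c' C' where s: "s > 0" "c' > 0" "C' > 0" "\<forall>\<^sub>F n in sequentially.
        c' * (real n ^ k * s ^ n) \<le> b n \<and> b n \<le> C' * (real n ^ k * s ^ n)"
      using b False unfolding power_exp_growth_def by blast
    show ?thesis
    proof (cases "s < r \<or> (s = r \<and> k < d)")
      case True
      have "\<forall>\<^sub>F n in sequentially. b n \<le> e * a n" if "e > 0" for e
      proof -
        have "\<forall>\<^sub>F n in sequentially. real n ^ k * s ^ n \<le> e * c / C' * (real n ^ d * r ^ n)"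
          by (rule cmp) (use r s that True in auto)
        then show ?thesis using r(4) s(4)
        proof eventually_elim
          case (elim n)
          have "b n \<le> C' * (real n ^ k * s ^ n)" using elim by simp
          also have "\<dots> \<le> C' * (e * c / C' * (real n ^ d * r ^ n))"
            using elim s by (intro mult_left_mono) auto
          also have "\<dots> = e * (c * (real n ^ d * r ^ n))" using s by simp
          also have "\<dots> \<le> e * a n" using elim that by (intro mult_left_mono) auto
          finally show ?case .
        qed
      qed
      then show ?thesis by (intro disjI2 allI impI)
    next
      case F: False
      have "\<forall>\<^sub>F n in sequentially. real n ^ d * r ^ n \<le> 1 * (real n ^ k * s ^ n)"
      proof (cases "r = s \<and> d = k")
        case True
        then show ?thesis by simp
      next
        case False
        show ?thesis by (rule cmp) (use r s F False in auto)
      qed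
      then have "\<forall>\<^sub>F n in sequentially. a n \<le> C / c' * b n"
        using r(4) s(4)
      proof eventually_elim
        case (elim n)
        have "a n \<le> C * (real n ^ d * r ^ n)" using elim by simp
        also have "\<dots> \<le> C * (real n ^ k * s ^ n)" using elim r by (intro mult_left_mono) auto
        also have "\<dots> = C / c' * (c' * (real n ^ k * s ^ n))" using s by simp
        also have "\<dots> \<le> C / c' * b n" using elim r s by (intro mult_left_mono) auto
        finally show ?case .
      qed
      moreover have "C / c' > 0" using r s by simp
      ultimately show ?thesis by (intro disjI1 exI[of _ "C / c'"] conjI)
    qed
  qed
qed

section \<open>Nonnegative matrices acting on functions\<close>

text \<open>Functions on all of \<open>nat\<close> replace vectors, so that iteration carries no
  dimension conditions. Only values below \<open>N\<close> are read, and values of the result from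
  \<open>N\<close> on are meaningless.\<close>

definition mat_app :: "nat \<Rightarrow> real mat \<Rightarrow> (nat \<Rightarrow> real) \<Rightarrow> nat \<Rightarrow> real" where
  "mat_app N A x i = (\<Sum>j<N. A $$ (i, j) * x j)"

lemma mat_app_cong: "(\<And>j. j < N \<Longrightarrow> x j = y j) \<Longrightarrow> mat_app N A x i = mat_app N A y i"
  by (simp add: mat_app_def)

lemma mat_app_scale: "mat_app N A (\<lambda>j. c * x j) i = c * mat_app N A x i"
  by (simp add: mat_app_def sum_distrib_left algebra_simps)

lemma mat_app_mono:
  assumes "\<And>j. j < N \<Longrightarrow> 0 \<le> A $$ (i, j)" "\<And>j. j < N \<Longrightarrow> x j \<le> y j"
  shows "mat_app N A x i \<le> mat_app N A y i"
  unfolding mat_app_def by (intro sum_mono mult_left_mono) (use assms in auto)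

lemma mat_app_iter_eq_pow:
  assumes A: "A \<in> carrier_mat N N" and i: "i < N"
  shows "(mat_app N A ^^ n) x i = (\<Sum>j<N. (A ^\<^sub>m n) $$ (i, j) * x j)"
proof (induction n arbitrary: x)
  case 0
  have "(\<Sum>j<N. 1\<^sub>m N $$ (i, j) * x j) = (\<Sum>j\<in>{i}. x j)"
    by (rule sum.mono_neutral_cong_right) (use i in auto)
  then show ?case using A by simp
next
  case (Suc n)
  have An: "A ^\<^sub>m n \<in> carrier_mat N N" using A by simp
  \<comment> \<open>Powers of matrices grow on the right, so the iteration is peeled from the inside
    and the induction hypothesis is applied to \<open>mat_app N A x\<close>.\<close>
  have "(mat_app N A ^^ Suc n) x i = (\<Sum>j<N. (A ^\<^sub>m n) $$ (i, j) * mat_app N A x j)"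
    unfolding funpow_Suc_right comp_def by (rule Suc.IH)
  also have "\<dots> = (\<Sum>j<N. \<Sum>k<N. (A ^\<^sub>m n) $$ (i, j) * A $$ (j, k) * x k)"
    by (simp add: mat_app_def sum_distrib_left mult.assoc)
  also have "\<dots> = (\<Sum>k<N. \<Sum>j<N. (A ^\<^sub>m n) $$ (i, j) * A $$ (j, k) * x k)"
    by (rule sum.swap)
  also have "\<dots> = (\<Sum>k<N. (A ^\<^sub>m Suc n) $$ (i, k) * x k)"
  proof (rule sum.cong)
    fix k assume "k \<in> {..<N}"
    then have "(A ^\<^sub>m n * A) $$ (i, k) = (\<Sum>j<N. (A ^\<^sub>m n) $$ (i, j) * A $$ (j, k))"
      using i A carrier_matD[OF An]
      by (auto simp: scalar_prod_def atLeast0LessThan simp del: pow_mat_dim intro!: sum.cong)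
    then show "(\<Sum>j<N. (A ^\<^sub>m n) $$ (i, j) * A $$ (j, k) * x k) = (A ^\<^sub>m Suc n) $$ (i, k) * x k"
      by (simp add: sum_distrib_right)
  qed simp
  finally show ?case .
qed

lemma mult_mat_vec_index_sum:
  assumes "A \<in> carrier_mat N N" "v \<in> carrier_vec N" "i < N"
  shows "(A *\<^sub>v v) $ i = (\<Sum>j<N. A $$ (i, j) * v $ j)"
  using assms by (auto simp: scalar_prod_def atLeast0LessThan intro!: sum.cong)

lemma mult_mat_vec_index:
  assumes "A \<in> carrier_mat N N" "v \<in> carrier_vec N" "i < N"
  shows "(A *\<^sub>v v) $ i = mat_app N A (($) v) i"
  using mult_mat_vec_index_sum[OF assms] by (simp add: mat_app_def)

lemma pow_mult_mat_vec_index: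
  assumes "A \<in> carrier_mat N N" "v \<in> carrier_vec N" "i < N"
  shows "((A ^\<^sub>m n) *\<^sub>v v) $ i = (mat_app N A ^^ n) (($) v) i"
  using mult_mat_vec_index_sum[OF pow_carrier_mat[OF assms(1)] assms(2,3)] mat_app_iter_eq_pow[OF assms(1,3)]
  by simp

text \<open>Collatz-Wielandt bound: in the maximum norm weighted by \<open>1 / x\<close> the matrix
  has operator norm at most \<open>t\<close>. It is read off at the component where an eigenvector
  of maximal modulus attains its weighted norm.\<close>

lemma real_spectral_radius_le:
  assumes A: "A \<in> carrier_mat N N" and N: "N > 0"
    and nonneg: "\<And>i j. i < N \<Longrightarrow> j < N \<Longrightarrow> 0 \<le> A $$ (i, j)"
    and x: "\<And>i. i < N \<Longrightarrow> 0 < x i" and Ax: "\<And>i. i < N \<Longrightarrow> mat_app N A x i \<le> t * x i"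
  shows "real_spectral_radius A \<le> t"
proof -
  let ?A = "map_mat complex_of_real A"
  have cA: "?A \<in> carrier_mat N N" using A by simp
  obtain \<mu> where ev: "eigenvalue ?A \<mu>" and rho: "real_spectral_radius A = norm \<mu>"
    using spectral_radius_mem_max(1)[OF cA N] by (auto simp: spectrum_def real_spectral_radius_def)
  obtain z where z: "z \<in> carrier_vec N" "z \<noteq> 0\<^sub>v N" "?A *\<^sub>v z = \<mu> \<cdot>\<^sub>v z"
    using ev A by (auto simp: eigenvalue_def eigenvector_def)
  define m where "m = Max ((\<lambda>i. norm (z $ i) / x i) ` {..<N})"
  have m_in: "m \<in> (\<lambda>i. norm (z $ i) / x i) ` {..<N}"
    unfolding m_def using N by (intro Max_in) auto
  have m_ge: "norm (z $ i) / x i \<le> m" if "i < N" for i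
    unfolding m_def using that by (intro Max_ge) auto
  have zm: "norm (z $ i) \<le> m * x i" if "i < N" for i
    using m_ge[OF that] x[OF that] by (simp add: field_simps)
  obtain i where i: "i < N" "m = norm (z $ i) / x i" using m_in by auto
  have m0: "m > 0"
  proof -
    obtain k where k: "k < N" "z $ k \<noteq> 0" using z(1,2) by (metis eq_vecI carrier_vecD index_zero_vec)
    then have "0 < norm (z $ k) / x k" using x by simp
    then show ?thesis using m_ge[OF k(1)] by linarith
  qed
  have "norm \<mu> * (m * x i) = norm (\<mu> * z $ i)" using i x[OF i(1)] by (simp add: norm_mult)
  also have "\<mu> * z $ i = (?A *\<^sub>v z) $ i" using z i by simp
  also have "\<dots> = (\<Sum>j<N. complex_of_real (A $$ (i, j)) * z $ j)"
    using A z(1) i(1) by (auto simp: scalar_prod_def atLeast0LessThan intro!: sum.cong)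
  also have "norm \<dots> \<le> (\<Sum>j<N. A $$ (i, j) * (m * x j))"
    by (rule sum_norm_le) (use nonneg i(1) zm in \<open>auto simp: norm_mult intro!: mult_left_mono\<close>)
  also have "\<dots> = m * mat_app N A x i" by (simp add: mat_app_def sum_distrib_left algebra_simps)
  also have "\<dots> \<le> m * (t * x i)" using Ax[OF i(1)] m0 by (intro mult_left_mono) auto
  finally have "norm \<mu> * (m * x i) \<le> t * (m * x i)" by (simp add: algebra_simps)
  then show ?thesis using m0 x[OF i(1)] rho by simp
qed

text \<open>A positive eigenvector can only belong to the spectral radius: the weighted norm bounds
  the radius from above, and \<open>t\<close> is itself an eigenvalue over the complex numbers.
  Positive radii thereby become positive eigenvalues.\<close>

lemma real_spectral_radius_eq:
  assumes A: "A \<in> carrier_mat N N" and N: "N > 0"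
    and nonneg: "\<And>i j. i < N \<Longrightarrow> j < N \<Longrightarrow> 0 \<le> A $$ (i, j)"
    and x: "\<And>i. i < N \<Longrightarrow> 0 < x i" and Ax: "\<And>i. i < N \<Longrightarrow> mat_app N A x i = t * x i"
  shows "real_spectral_radius A = t"
proof (rule antisym)
  show "real_spectral_radius A \<le> t"
    by (rule real_spectral_radius_le[OF A N nonneg x]) (use Ax in auto)
  let ?A = "map_mat complex_of_real A"
  have cA: "?A \<in> carrier_mat N N" using A by simp
  define z where "z = vec N (\<lambda>i. complex_of_real (x i))"
  have "?A *\<^sub>v z = of_real t \<cdot>\<^sub>v z"
  proof (rule eq_vecI)
    fix i assume "i < dim_vec (of_real t \<cdot>\<^sub>v z)"
    then have i: "i < N" by (simp add: z_def)
    have "(?A *\<^sub>v z) $ i = (\<Sum>j<N. complex_of_real (A $$ (i, j)) * of_real (x j))"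
      using A i by (auto simp: scalar_prod_def z_def atLeast0LessThan intro!: sum.cong)
    also have "\<dots> = of_real (mat_app N A x i)" by (simp add: mat_app_def)
    finally show "(?A *\<^sub>v z) $ i = (of_real t \<cdot>\<^sub>v z) $ i" using i by (simp add: Ax z_def)
  qed (use A in \<open>simp add: z_def\<close>)
  moreover have "z \<noteq> 0\<^sub>v N"
  proof
    assume "z = 0\<^sub>v N"
    then have "z $ 0 = 0" using N by simp
    then show False using N x[OF N] by (simp add: z_def)
  qed
  ultimately have "eigenvalue ?A (of_real t)"
    unfolding eigenvalue_def eigenvector_def using A by (intro exI[of _ z]) (simp add: z_def)
  then have "norm (complex_of_real t) \<le> real_spectral_radius A"
    unfolding real_spectral_radius_def
    by (intro spectral_radius_mem_max(2)[OF cA N] imageI) (simp add: spectrum_def)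
  then show "t \<le> real_spectral_radius A" by simp
qed

text \<open>Strict positivity of \<open>x\<close> yields \<open>A x \<le> C x\<close>, which
  monotonicity carries along the orbit. This is the growth condition that rules out oscillation of
  the leading part.\<close>

lemma power_exp_growth_mat_app:
  assumes A: "A \<in> carrier_mat N N"
    and nonneg: "\<And>i j. i < N \<Longrightarrow> j < N \<Longrightarrow> 0 \<le> A $$ (i, j)"
    and x: "\<And>i. i < N \<Longrightarrow> 0 < x i" and i: "i < N"
  shows "power_exp_growth (\<lambda>n. (mat_app N A ^^ n) x i)"
    and "\<exists>C>0. \<forall>n. (mat_app N A ^^ Suc n) x i \<le> C * (mat_app N A ^^ n) x i"
proof -
  have pos: "(mat_app N A ^^ n) x j \<ge> 0" if "j < N" for n j
    using that
  proof (induction n arbitrary: j)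
    case 0
    then show ?case using x[of j] by simp
  next
    case (Suc n)
    then show ?case using nonneg by (auto simp: mat_app_def intro!: sum_nonneg)
  qed
  define C where "C = 1 + (\<Sum>j<N. \<bar>mat_app N A x j\<bar> / x j)"
  have C: "C > 0" "mat_app N A x j \<le> C * x j" if "j < N" for j
  proof -
    show "C > 0" unfolding C_def using x by (intro add_pos_nonneg sum_nonneg) (auto simp: less_imp_le)
    have "\<bar>mat_app N A x j\<bar> / x j \<le> (\<Sum>j<N. \<bar>mat_app N A x j\<bar> / x j)"
      by (rule member_le_sum) (use that x in \<open>auto simp: less_imp_le\<close>)
    then have "\<bar>mat_app N A x j\<bar> / x j \<le> C" by (simp add: C_def)
    then show "mat_app N A x j \<le> C * x j" using x[OF that] by (simp add: field_simps)
  qed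
  have Suc_le: "(mat_app N A ^^ Suc n) x j \<le> C * (mat_app N A ^^ n) x j" if "j < N" for n j
    using that
  proof (induction n arbitrary: j)
    case 0
    then show ?case using C by simp
  next
    case (Suc n)
    have "(mat_app N A ^^ Suc (Suc n)) x j = mat_app N A ((mat_app N A ^^ Suc n) x) j" by simp
    also have "\<dots> \<le> mat_app N A (\<lambda>k. C * (mat_app N A ^^ n) x k) j"
      by (rule mat_app_mono) (use nonneg Suc in auto)
    also have "\<dots> = C * (mat_app N A ^^ Suc n) x j" by (simp add: mat_app_scale)
    finally show ?case .
  qed
  then show "\<exists>C>0. \<forall>n. (mat_app N A ^^ Suc n) x i \<le> C * (mat_app N A ^^ n) x i"
    using C(1)[OF i] i by blast
  let ?A = "map_mat complex_of_real A"
  have cA: "?A \<in> carrier_mat N N" using A by simp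
  have "?A ^\<^sub>m n = map_mat complex_of_real (A ^\<^sub>m n)" for n
    by (rule of_real_hom.mat_hom_pow[OF A, symmetric])
  then have "complex_of_real ((mat_app N A ^^ n) x i) = (\<Sum>j<N. of_real (x j) * (?A ^\<^sub>m n) $$ (i, j))" for n
    using carrier_matD[OF pow_carrier_mat[OF A, of n]] i
    unfolding mat_app_iter_eq_pow[OF A i] of_real_sum
    by (intro sum.cong) (auto simp: mult.commute simp del: pow_mat_dim)
  moreover have "binomial_exp_sum (\<lambda>n. \<Sum>j<N. of_real (x j) * (?A ^\<^sub>m n) $$ (i, j))"
    by (intro binomial_exp_sum_sum binomial_exp_sum_cmult binomial_exp_sum_pow_mat[OF cA i]) auto
  ultimately have "binomial_exp_sum (\<lambda>n. complex_of_real ((mat_app N A ^^ n) x i))" by simp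
  then obtain F c where "finite F" "\<forall>p\<in>F. fst p \<noteq> 0" "\<forall>\<^sub>F n in sequentially.
        complex_of_real ((mat_app N A ^^ n) x i) = (\<Sum>p\<in>F. c p * (of_nat (n choose snd p) * fst p ^ n))"
    unfolding binomial_exp_sum_def by blast
  then show "power_exp_growth (\<lambda>n. (mat_app N A ^^ n) x i)"
    by (rule power_exp_growth_of_binomial_exp_sum[where C = C]) (use pos[OF i] C(1)[OF i] Suc_le[OF i] in auto)
qed

section \<open>Limits of minima, and sequences multiplicative up to a constant\<close>

lemma tendsto_Min_image:
  fixes f :: "'a \<Rightarrow> nat \<Rightarrow> real"
  assumes "finite K" "K \<noteq> {}" "\<And>A. A \<in> K \<Longrightarrow> f A \<longlonglongrightarrow> l A"
  shows "(\<lambda>n. Min ((\<lambda>A. f A n) ` K)) \<longlonglongrightarrow> Min (l ` K)"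
  using assms
proof (induction K rule: finite_ne_induct)
  case (insert A K)
  then show ?case by (simp add: tendsto_min)
qed simp

text \<open>A two-sided form of Fekete's argument: \<open>a / q\<close> is supermultiplicative and
  \<open>q * a\<close> is submultiplicative, so any number separating the \<open>n\<close>-th roots
  of the former from those of the latter is a growth rate with constant \<open>q\<close> on both
  sides.\<close>

lemma quasi_multiplicative_growth:
  fixes a :: "nat \<Rightarrow> real"
  assumes q: "q \<ge> 1" and n0: "n0 \<ge> 1" and pos: "\<And>n. n \<ge> n0 \<Longrightarrow> a n > 0"
    and up: "\<And>n k. n \<ge> n0 \<Longrightarrow> k \<ge> n0 \<Longrightarrow> a (n + k) \<le> q * (a n * a k)"
    and lo: "\<And>n k. n \<ge> n0 \<Longrightarrow> k \<ge> n0 \<Longrightarrow> a n * a k \<le> q * a (n + k)"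
  shows "\<exists>r>0. \<forall>n\<ge>n0. r ^ n \<le> q * a n \<and> a n \<le> q * r ^ n"
proof -
  have pos0: "a n / q > 0" "q * a n > 0" if "n \<ge> n0" for n using pos[OF that] q by auto
  have mult_ge: "n * Suc k \<ge> n0" if "n \<ge> n0" for n k :: nat
    using that by (simp add: trans_le_add1)
  have lower: "(a n / q) ^ Suc k \<le> a (n * Suc k) / q" if n: "n \<ge> n0" for n k
  proof (induction k)
    case (Suc k)
    have "(a n / q) ^ Suc (Suc k) = a n / q * (a n / q) ^ Suc k" by simp
    also have "\<dots> \<le> a n / q * (a (n * Suc k) / q)"
      using Suc pos0[OF n] by (intro mult_left_mono) auto
    also have "\<dots> \<le> a (n * Suc (Suc k)) / q"
      using lo[OF n mult_ge[OF n, of k]] q by (simp add: field_simps)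
    finally show ?case .
  qed simp
  have upper: "q * a (n * Suc k) \<le> (q * a n) ^ Suc k" if n: "n \<ge> n0" for n k
  proof (induction k)
    case (Suc k)
    have "a (n * Suc (Suc k)) \<le> q * (a n * a (n * Suc k))"
      using up[OF n mult_ge[OF n, of k]] by simp
    then have "q * a (n * Suc (Suc k)) \<le> q * (q * (a n * a (n * Suc k)))"
      using q by (intro mult_left_mono) auto
    also have "\<dots> = q * a n * (q * a (n * Suc k))" by simp
    also have "\<dots> \<le> q * a n * (q * a n) ^ Suc k"
      using Suc pos0[OF n] by (intro mult_left_mono) auto
    finally show ?case by simp
  qed simp
  \<comment> \<open>The lower estimate along multiples of \<open>n\<close> and the upper one along
    multiples of \<open>k\<close> meet at \<open>n * k\<close>.\<close>
  have cross: "root n (a n / q) \<le> root k (q * a k)" if n: "n \<ge> n0" and k: "k \<ge> n0" for n k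
  proof -
    obtain n' k' where nk: "n = Suc n'" "k = Suc k'" using n k n0 by (cases n; cases k) auto
    have "(a n / q) ^ k \<le> a (n * k) / q" using lower[OF n, of k'] nk by simp
    also have "\<dots> \<le> q * a (n * k)"
    proof -
      have "a (n * k) > 0" using pos mult_ge[OF n, of k'] nk by simp
      moreover have "1 \<le> q * q" using q mult_mono[of 1 q 1 q] by simp
      ultimately have "a (n * k) * 1 \<le> a (n * k) * (q * q)" by (intro mult_left_mono) auto
      then show ?thesis using q by (simp add: field_simps)
    qed
    also have "\<dots> \<le> (q * a k) ^ n" using upper[OF k, of n'] nk by (simp add: mult.commute)
    finally have *: "(a n / q) ^ k \<le> (q * a k) ^ n" .
    have "root n (a n / q) ^ (n * k) \<le> root k (q * a k) ^ (n * k)"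
    proof -
      have "root n (a n / q) ^ (n * k) = (a n / q) ^ k"
        unfolding power_mult using pos0[OF n] n n0 by (simp add: real_root_pow_pos2)
      moreover have "root k (q * a k) ^ (n * k) = (q * a k) ^ n"
        unfolding mult.commute[of n k] power_mult using pos0[OF k] k n0
        by (simp add: real_root_pow_pos2)
      ultimately show ?thesis using * by simp
    qed
    moreover have "0 \<le> root k (q * a k)" using pos0[OF k] by (simp add: real_root_ge_zero)
    ultimately show ?thesis using nk by (metis power_le_imp_le_base mult_Suc_right add_Suc)
  qed
  define r where "r = (SUP n\<in>{n0..}. root n (a n / q))"
  have bdd: "bdd_above ((\<lambda>n. root n (a n / q)) ` {n0..})"
    using cross[of _ n0] by (intro bdd_aboveI2[of _ _ "root n0 (q * a n0)"]) auto
  have r_ge: "root n (a n / q) \<le> r" if "n \<ge> n0" for n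
    unfolding r_def using that bdd by (intro cSUP_upper) auto
  have r_le: "r \<le> root n (q * a n)" if "n \<ge> n0" for n
    unfolding r_def using that cross by (intro cSUP_least) auto
  have r0: "r > 0"
  proof -
    have "0 < root n0 (a n0 / q)" using pos0[of n0] n0 by (simp add: real_root_gt_zero)
    then show ?thesis using r_ge[of n0] by simp
  qed
  have "r ^ n \<le> q * a n \<and> a n \<le> q * r ^ n" if n: "n \<ge> n0" for n
  proof
    have n1: "n > 0" using n n0 by simp
    have "r ^ n \<le> root n (q * a n) ^ n" using r_le[OF n] r0 by (intro power_mono) auto
    then show "r ^ n \<le> q * a n" using n1 pos0[OF n] by (simp add: real_root_pow_pos2)
    have "root n (a n / q) ^ n \<le> r ^ n"
      using r_ge[OF n] pos0[OF n] n1 by (intro power_mono) (auto simp: real_root_ge_zero)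
    then have "a n / q \<le> r ^ n" using n1 pos0[OF n] by (simp add: real_root_pow_pos2)
    then show "a n \<le> q * r ^ n" using q by (simp add: field_simps)
  qed
  then show ?thesis using r0 by blast
qed

section \<open>Finite families with the product property\<close>

locale product_family =
  fixes N :: nat and K :: "real mat set"
  assumes N_pos: "N > 0"
    and finite_K: "finite K" and K_nonempty: "K \<noteq> {}"
    and carrier: "A \<in> K \<Longrightarrow> A \<in> carrier_mat N N"
    and nonneg: "A \<in> K \<Longrightarrow> i < N \<Longrightarrow> j < N \<Longrightarrow> 0 \<le> A $$ (i, j)"
    and product: "product_property N K"
begin

abbreviation ap :: "real mat \<Rightarrow> (nat \<Rightarrow> real) \<Rightarrow> nat \<Rightarrow> real" where
  "ap \<equiv> mat_app N"

definition F :: "(nat \<Rightarrow> real) \<Rightarrow> nat \<Rightarrow> real" where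
  "F x i = Min ((\<lambda>A. ap A x i) ` K)"

lemma F_le: "A \<in> K \<Longrightarrow> F x i \<le> ap A x i"
  unfolding F_def using finite_K by (intro Min_le) auto

lemma F_attained: "\<exists>A\<in>K. F x i = ap A x i"
proof -
  have "F x i \<in> (\<lambda>A. ap A x i) ` K"
    unfolding F_def using finite_K K_nonempty by (intro Min_in) auto
  then show ?thesis by auto
qed

lemma F_cong: "(\<And>j. j < N \<Longrightarrow> x j = y j) \<Longrightarrow> F x i = F y i"
  unfolding F_def using mat_app_cong[of N x y] by metis

lemma F_mono:
  assumes "i < N" "\<And>j. j < N \<Longrightarrow> x j \<le> y j"
  shows "F x i \<le> F y i"
proof -
  obtain A where A: "A \<in> K" "F y i = ap A y i" using F_attained by blast
  have "F x i \<le> ap A x i" using A by (intro F_le)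
  also have "\<dots> \<le> ap A y i" using A nonneg assms by (intro mat_app_mono) auto
  finally show ?thesis using A by simp
qed

lemma F_scale:
  assumes "c \<ge> 0"
  shows "F (\<lambda>j. c * x j) i = c * F x i"
proof (rule antisym)
  show "F (\<lambda>j. c * x j) i \<le> c * F x i"
    using F_attained[of x i] F_le[of _ "\<lambda>j. c * x j" i] by (auto simp: mat_app_scale)
  obtain A where A: "A \<in> K" "F (\<lambda>j. c * x j) i = ap A (\<lambda>j. c * x j) i"
    using F_attained by blast
  then show "c * F x i \<le> F (\<lambda>j. c * x j) i"
    using mult_left_mono[OF F_le[OF A(1), of x i] assms] by (simp add: mat_app_scale)
qed

lemma F_nonneg:
  assumes "i < N" "\<And>j. j < N \<Longrightarrow> 0 \<le> x j"
  shows "0 \<le> F x i"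
  using F_attained[of x i] nonneg assms by (auto simp: mat_app_def intro!: sum_nonneg)

lemma F_iter_mono:
  assumes "i < N" "\<And>j. j < N \<Longrightarrow> x j \<le> y j"
  shows "(F ^^ n) x i \<le> (F ^^ n) y i"
  using assms(1) by (induction n arbitrary: i) (auto intro!: F_mono simp: assms(2))

lemma F_iter_scale:
  assumes "c \<ge> 0"
  shows "(F ^^ n) (\<lambda>j. c * x j) i = c * (F ^^ n) x i"
proof (induction n arbitrary: i)
  case (Suc n)
  then have "(F ^^ n) (\<lambda>j. c * x j) = (\<lambda>j. c * (F ^^ n) x j)" by auto
  then show ?case by (simp add: F_scale[OF assms])
qed simp

lemma F_iter_nonneg:
  assumes "i < N" "\<And>j. j < N \<Longrightarrow> 0 \<le> x j"
  shows "0 \<le> (F ^^ n) x i"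
  using assms(1) by (induction n arbitrary: i) (auto intro!: F_nonneg simp: assms(2))

lemma F_iter_le_ap_iter:
  assumes "A \<in> K" "i < N"
  shows "(F ^^ n) x i \<le> (ap A ^^ n) x i"
  using assms(2)
proof (induction n arbitrary: i)
  case (Suc n)
  have "(F ^^ Suc n) x i \<le> F ((ap A ^^ n) x) i" using Suc by (auto intro: F_mono)
  also have "\<dots> \<le> (ap A ^^ Suc n) x i" using F_le[OF assms(1)] by simp
  finally show ?case .
qed simp

lemma ap_iter_mono:
  assumes "A \<in> K" "i < N" "\<And>j. j < N \<Longrightarrow> x j \<le> y j"
  shows "(ap A ^^ n) x i \<le> (ap A ^^ n) y i"
  using assms(2) by (induction n arbitrary: i) (auto intro!: mat_app_mono nonneg simp: assms(1,3))

lemma ap_iter_scale: "(ap A ^^ n) (\<lambda>j. c * x j) i = c * (ap A ^^ n) x i"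
proof (induction n arbitrary: i)
  case (Suc n)
  then have "(ap A ^^ n) (\<lambda>j. c * x j) = (\<lambda>j. c * (ap A ^^ n) x j)" by auto
  then show ?case by (simp add: mat_app_scale)
qed simp

lemma tendsto_F:
  assumes "\<And>j. j < N \<Longrightarrow> (\<lambda>n. x n j) \<longlonglongrightarrow> u j"
  shows "(\<lambda>n. F (x n) i) \<longlonglongrightarrow> F u i"
  unfolding F_def mat_app_def using finite_K K_nonempty
  by (intro tendsto_Min_image tendsto_sum tendsto_mult tendsto_const assms) auto

text \<open>The product property mixes only two members; fixing one further row at a time, with
  \<open>V\<close> the rows already settled, reaches any choice of rows.\<close>

lemma row_selection:
  assumes "\<And>i. i < N \<Longrightarrow> S i \<in> K"
  shows "\<exists>A\<in>K. \<forall>i<N. \<forall>j<N. A $$ (i, j) = S i $$ (i, j)"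
proof -
  have "\<exists>A\<in>K. \<forall>i<m. \<forall>j<N. A $$ (i, j) = S i $$ (i, j)" if "m \<le> N" for m
    using that
  proof (induction m)
    case 0
    then show ?case using K_nonempty by auto
  next
    case (Suc m)
    then obtain A where A: "A \<in> K" "\<forall>i<m. \<forall>j<N. A $$ (i, j) = S i $$ (i, j)" by auto
    define C where "C = mat N N (\<lambda>(i, j). if i \<in> {0..<m} then A $$ (i, j) else S m $$ (i, j))"
    have V: "{0..<m} \<subseteq> {0..<N}" and Sm: "S m \<in> K" using Suc.prems assms by auto
    have "C \<in> K"
      unfolding C_def
      by (rule product[unfolded product_property_def, rule_format, OF V A(1) Sm])
    moreover have "\<forall>i<Suc m. \<forall>j<N. C $$ (i, j) = S i $$ (i, j)"
      using A Suc.prems by (auto simp: C_def less_Suc_eq)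
    ultimately show ?case by blast
  qed
  from this[of N] show ?thesis by simp
qed

text \<open>The vector \<open>X i\<close> may vary with the row. This freedom allows rows that are
  optimal at different times of an orbit to be collected in one matrix.\<close>

lemma greedy_selection: "\<exists>A\<in>K. \<forall>i<N. ap A (X i) i = F (X i) i"
proof -
  obtain S where S: "\<And>i. S i \<in> K" "\<And>i. F (X i) i = ap (S i) (X i) i"
    using F_attained[of "X i" i for i] by metis
  obtain A where A: "A \<in> K" "\<forall>i<N. \<forall>j<N. A $$ (i, j) = S i $$ (i, j)"
    using row_selection[of S] S by blast
  then have "\<forall>i<N. ap A (X i) i = F (X i) i" by (simp add: S(2) mat_app_def)
  then show ?thesis using A by blast
qed

text \<open>By monotonicity and homogeneity the normalised orbit of a supersolution decreases, and
  continuity of \<open>F\<close> makes its limit an eigenvector. The minorant \<open>m\<close>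
  decides how much positivity survives: it is a positive constant in one use and 0 in the
  other.\<close>

lemma supersolution_limit:
  assumes r: "r > 0" and Fx: "\<And>i. i < N \<Longrightarrow> F x i \<le> r * x i"
    and m: "\<And>n i. i < N \<Longrightarrow> m i * r ^ n \<le> (F ^^ n) x i"
  obtains u where "\<And>i. i < N \<Longrightarrow> m i \<le> u i" "\<And>i. i < N \<Longrightarrow> F u i = r * u i"
    "\<And>i. i < N \<Longrightarrow> (\<lambda>n. (F ^^ n) x i / r ^ n) \<longlonglongrightarrow> u i"
    "\<And>n i. i < N \<Longrightarrow> u i \<le> (F ^^ n) x i / r ^ n"
proof -
  define y where "y n i = (F ^^ n) x i / r ^ n" for n i
  have step: "(F ^^ Suc n) x i \<le> r * (F ^^ n) x i" if "i < N" for n i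
  proof -
    have "(F ^^ Suc n) x i = (F ^^ n) (F x) i" by (simp add: funpow_swap1)
    also have "\<dots> \<le> (F ^^ n) (\<lambda>j. r * x j) i" by (rule F_iter_mono) (use that Fx in auto)
    also have "\<dots> = r * (F ^^ n) x i" using r by (simp add: F_iter_scale)
    finally show ?thesis .
  qed
  have dec: "decseq (\<lambda>n. y n i)" if "i < N" for i
    using step[OF that] r by (intro decseq_SucI) (simp add: y_def field_simps)
  have bd: "m i \<le> y n i" if "i < N" for i n
    using m[OF that, of n] r by (simp add: y_def field_simps)
  have "\<exists>L. (\<lambda>n. y n i) \<longlonglongrightarrow> L \<and> (\<forall>n. L \<le> y n i)" if i: "i < N" for i
    using decseq_convergent[OF dec[OF i], of "m i"] bd[OF i] by metis
  then obtain u where u: "\<And>i. i < N \<Longrightarrow> (\<lambda>n. y n i) \<longlonglongrightarrow> u i"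
      "\<And>i n. i < N \<Longrightarrow> u i \<le> y n i" by metis
  have Fy: "F (y n) i = r * y (Suc n) i" for n i
  proof -
    have y_eq: "y n = (\<lambda>j. (1 / r ^ n) * (F ^^ n) x j)" by (auto simp: y_def)
    have "F (y n) i = (1 / r ^ n) * F ((F ^^ n) x) i"
      unfolding y_eq by (rule F_scale) (use r in simp)
    then show ?thesis using r by (simp add: y_def)
  qed
  have "F u i = r * u i" if i: "i < N" for i
  proof (rule LIMSEQ_unique)
    show "(\<lambda>n. F (y n) i) \<longlonglongrightarrow> F u i" by (rule tendsto_F) (rule u)
    show "(\<lambda>n. F (y n) i) \<longlonglongrightarrow> r * u i"
      unfolding Fy by (intro tendsto_mult tendsto_const LIMSEQ_Suc u i)
  qed
  moreover have "m i \<le> u i" if i: "i < N" for i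
    using u(1)[OF i] bd[OF i] by (intro LIMSEQ_le_const) auto
  ultimately show thesis using that u unfolding y_def by blast
qed

text \<open>The normalised orbit \<open>y\<close> need not converge; for a permutation matrix it is
  periodic. Its lower limit is a supersolution, and from there the iteration does converge.\<close>

lemma pos_eigenvector_of_bounds:
  assumes r: "r > 0" and c: "c > 0"
    and x: "\<And>n i. i < N \<Longrightarrow> c * r ^ n \<le> (F ^^ n) x i"
      "\<And>n i. i < N \<Longrightarrow> (F ^^ n) x i \<le> C * r ^ n"
  obtains u where "\<And>i. i < N \<Longrightarrow> 0 < u i" "\<And>i. i < N \<Longrightarrow> F u i = r * u i"
proof -
  define y where "y n i = (F ^^ n) x i / r ^ n" for n i
  have Fy: "F (y n) i = r * y (Suc n) i" for n i
  proof -
    have y_eq: "y n = (\<lambda>j. (1 / r ^ n) * (F ^^ n) x j)" by (auto simp: y_def)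
    have "F (y n) i = (1 / r ^ n) * F ((F ^^ n) x) i"
      unfolding y_eq by (rule F_scale) (use r in simp)
    then show ?thesis using r by (simp add: y_def)
  qed
  have y: "c \<le> y n i" "y n i \<le> C" if "i < N" for n i
    using x[OF that, of n] r by (auto simp: y_def field_simps)
  define w where "w k i = (INF n\<in>{k..}. y n i)" for k i
  have bdd: "bdd_below ((\<lambda>n. y n i) ` {k..})" if "i < N" for i k
    using y(1)[OF that] by (intro bdd_belowI2[of _ c]) auto
  have w_le: "w k i \<le> y n i" if "i < N" "n \<ge> k" for i k n
    unfolding w_def using that bdd by (intro cINF_lower) auto
  have c_le: "c \<le> w k i" if "i < N" for k i
    unfolding w_def using y(1)[OF that] by (intro cINF_greatest) auto
  have inc: "incseq (\<lambda>k. w k i)" if "i < N" for i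
    unfolding w_def incseq_def using bdd[OF that] by (auto intro!: cINF_superset_mono)
  have "\<exists>L. (\<lambda>k. w k i) \<longlonglongrightarrow> L \<and> (\<forall>k. w k i \<le> L)" if i: "i < N" for i
    using incseq_convergent[OF inc[OF i], of C] w_le[OF i order_refl] y(2)[OF i] by (metis order_trans)
  then obtain z where z: "\<And>i. i < N \<Longrightarrow> (\<lambda>k. w k i) \<longlonglongrightarrow> z i"
      "\<And>i k. i < N \<Longrightarrow> w k i \<le> z i" by metis
  \<comment> \<open>Every \<open>y n\<close> with \<open>n > k\<close> is the image under
    \<open>F / r\<close> of some \<open>y n'\<close> with \<open>n' \<ge> k\<close>, which lies
    above the tail infimum \<open>w k\<close>.\<close>
  have Fw: "F (w k) i \<le> r * z i" if i: "i < N" for k i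
  proof -
    have "F (w k) i / r \<le> w (Suc k) i"
      unfolding w_def[of "Suc k"]
    proof (rule cINF_greatest)
      fix n assume n: "n \<in> {Suc k..}"
      then obtain n' where n': "n = Suc n'" "n' \<ge> k" by (cases n) auto
      have "F (w k) i \<le> F (y n') i" by (rule F_mono) (use i w_le n' in auto)
      then show "F (w k) i / r \<le> y n i" using r n' by (simp add: Fy field_simps)
    qed simp
    also have "\<dots> \<le> z i" by (rule z(2)[OF i])
    finally show ?thesis using r by (simp add: field_simps)
  qed
  have Fz: "F z i \<le> r * z i" if i: "i < N" for i
  proof (rule LIMSEQ_le_const2)
    show "(\<lambda>k. F (w k) i) \<longlonglongrightarrow> F z i" by (rule tendsto_F) (rule z)
  qed (use Fw[OF i] in auto)
  have C: "C > 0" using y[OF N_pos, of 0] c by simp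
  \<comment> \<open>Since \<open>x \<le> C\<close> and \<open>z \<ge> c\<close>, a multiple of
    \<open>x\<close> lies below \<open>z\<close>. Hence the orbit of \<open>z\<close> inherits a
    lower bound of order \<open>r^n\<close>, and the limit eigenvector stays positive.\<close>
  have zc: "c / C * x j \<le> z j" if j: "j < N" for j
  proof -
    have "c / C * x j \<le> c / C * C"
      using x(2)[OF j, of 0] c C by (intro mult_left_mono) auto
    also have "\<dots> = c" using C by simp
    also have "\<dots> \<le> z j" using c_le[OF j, of 0] z(2)[OF j, of 0] by simp
    finally show ?thesis .
  qed
  have zn: "c / C * c * r ^ n \<le> (F ^^ n) z i" if i: "i < N" for n i
  proof -
    have "c / C * c * r ^ n \<le> c / C * (F ^^ n) x i"
      using x(1)[OF i, of n] c C by (simp add: mult.assoc mult_left_mono del: times_divide_eq_left)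
    also have "\<dots> = (F ^^ n) (\<lambda>j. c / C * x j) i" using c C by (subst F_iter_scale) auto
    also have "\<dots> \<le> (F ^^ n) z i" by (rule F_iter_mono) (use i zc in auto)
    finally show ?thesis .
  qed
  obtain u where u: "\<And>i. i < N \<Longrightarrow> c / C * c \<le> u i" "\<And>i. i < N \<Longrightarrow> F u i = r * u i"
    using supersolution_limit[of r z "\<lambda>_. c / C * c", OF r Fz zn] by metis
  have "0 < u i" if "i < N" for i
    by (rule less_le_trans[OF _ u(1)[OF that]]) (use c C in simp)
  then show thesis using that u(2) by blast
qed

lemma F_iter_nonzero:
  assumes rho: "\<And>A. A \<in> K \<Longrightarrow> 0 < real_spectral_radius A"
  shows "\<exists>i<N. (F ^^ n) (\<lambda>_. 1) i > 0"
proof (rule ccontr)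
  let ?o = "\<lambda>_. 1 :: real"
  assume "\<not> ?thesis"
  then have zero: "(F ^^ n) ?o i = 0" if "i < N" for i
    using that F_iter_nonneg[of i ?o n] by force
  \<comment> \<open>\<open>k i\<close> is the first time at which component \<open>i\<close>
    vanishes. With row \<open>i\<close> greedy for time \<open>k i - 1\<close>, its nonzero entries
    lead only to indices with smaller \<open>k\<close>.\<close>
  define k where "k i = (LEAST k. (F ^^ k) ?o i = 0)" for i
  have k0: "(F ^^ k i) ?o i = 0" if "i < N" for i
    unfolding k_def by (rule LeastI) (rule zero[OF that])
  have k_le: "k i \<le> l" if "(F ^^ l) ?o i = 0" for i l
    unfolding k_def using that by (rule Least_le)
  have k_pos: "k i > 0" if "i < N" for i
    using k0[OF that] by (cases "k i") auto
  obtain A where A: "A \<in> K" "\<forall>i<N. ap A ((F ^^ (k i - 1)) ?o) i = F ((F ^^ (k i - 1)) ?o) i"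
    using greedy_selection[of "\<lambda>i. (F ^^ (k i - 1)) ?o"] by blast
  have dec: "k j < k i" if ij: "i < N" "j < N" "A $$ (i, j) \<noteq> 0" for i j
  proof -
    obtain l where l: "k i = Suc l" using k_pos[OF ij(1)] by (cases "k i") auto
    have "ap A ((F ^^ l) ?o) i = 0" using A ij(1) l k0[OF ij(1)] by (metis diff_Suc_1 funpow.simps(2) comp_apply)
    then have "A $$ (i, j) * (F ^^ l) ?o j = 0"
      unfolding mat_app_def using ij A(1) nonneg F_iter_nonneg[of _ ?o l]
      by (subst (asm) sum_nonneg_eq_0_iff) auto
    then show ?thesis using ij k_le[of l j] l by simp
  qed
  define s where "s = 1 + (\<Sum>i<N. \<Sum>j<N. A $$ (i, j))"
  have s: "(\<Sum>j<N. A $$ (i, j)) \<le> s" if "i < N" for i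
  proof -
    have "(\<Sum>j<N. A $$ (i, j)) \<le> (\<Sum>i<N. \<Sum>j<N. A $$ (i, j))"
      using that A nonneg by (intro member_le_sum) (auto intro!: sum_nonneg)
    then show ?thesis by (simp add: s_def)
  qed
  have s1: "s \<ge> 1" unfolding s_def using A nonneg by (auto intro!: sum_nonneg)
  \<comment> \<open>Nilpotency is expressed through the weights \<open>T ^ k i\<close>: each nonzero
    entry of row \<open>i\<close> meets a weight of at most \<open>T ^ (k i - 1)\<close>, so the
    action gains a factor \<open>1 / T\<close>.\<close>
  have bound: "real_spectral_radius A \<le> s / T" if T: "T \<ge> 1" for T
  proof (rule real_spectral_radius_le[where x = "\<lambda>i. T ^ k i"])
    fix i assume i: "i < N"
    obtain l where l: "k i = Suc l" using k_pos[OF i] by (cases "k i") auto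
    have "ap A (\<lambda>i. T ^ k i) i \<le> (\<Sum>j<N. A $$ (i, j) * T ^ l)"
      unfolding mat_app_def
    proof (rule sum_mono)
      fix j assume "j \<in> {..<N}"
      then have j: "j < N" by simp
      show "A $$ (i, j) * T ^ k j \<le> A $$ (i, j) * T ^ l"
      proof (cases "A $$ (i, j) = 0")
        case False
        then have "k j \<le> l" using dec[OF i j] l by simp
        then show ?thesis using T nonneg[OF A(1) i j] by (intro mult_left_mono power_increasing) auto
      qed simp
    qed
    also have "\<dots> = (\<Sum>j<N. A $$ (i, j)) * T ^ l" by (simp add: sum_distrib_right)
    also have "\<dots> \<le> s * T ^ l" using s[OF i] T by (intro mult_right_mono) auto
    also have "\<dots> = s / T * T ^ k i" using T l by simp
    finally show "ap A (\<lambda>i. T ^ k i) i \<le> s / T * T ^ k i" .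
  qed (use carrier A nonneg N_pos T in auto)
  define \<rho> where "\<rho> = real_spectral_radius A"
  have "\<rho> > 0" unfolding \<rho>_def by (rule rho) (rule A)
  have "\<rho> \<le> s" using bound[of 1] by (simp add: \<rho>_def)
  \<comment> \<open>The choice \<open>T = 2 * s / \<rho>\<close> gives
    \<open>\<rho> \<le> \<rho> / 2\<close>; \<open>\<rho> \<le> s\<close> ensures
    \<open>T \<ge> 1\<close>.\<close>
  then have "\<rho> \<le> s / (2 * s / \<rho>)"
    unfolding \<rho>_def using \<open>\<rho> > 0\<close> s1 by (intro bound) (simp add: field_simps \<rho>_def)
  then show False using \<open>\<rho> > 0\<close> s1 by simp
qed

text \<open>Balance squeezes the \<open>n\<close>-th iterate between multiples
  \<open>a n / q\<close> and \<open>q * a n\<close> of the constant vector 1, where component 0 is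
  taken as reference. Iterating \<open>k\<close> further times yields both multiplicative
  inequalities for \<open>a\<close>.\<close>

lemma bounds_of_balanced:
  assumes rho: "\<And>A. A \<in> K \<Longrightarrow> 0 < real_spectral_radius A"
    and bal: "\<And>i j. i < N \<Longrightarrow> j < N \<Longrightarrow>
       \<exists>q. \<forall>\<^sub>F n in sequentially. (F ^^ n) (\<lambda>_. 1) i \<le> q * (F ^^ n) (\<lambda>_. 1) j"
  shows "\<exists>r>0. \<exists>c>0. \<exists>C. \<forall>\<^sub>F n in sequentially. \<forall>i<N.
     c * r ^ n \<le> (F ^^ n) (\<lambda>_. 1) i \<and> (F ^^ n) (\<lambda>_. 1) i \<le> C * r ^ n"
proof -
  define f where "f n i = (F ^^ n) (\<lambda>_. 1) i" for n i
  have f_nonneg: "0 \<le> f n i" if "i < N" for n i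
    unfolding f_def by (rule F_iter_nonneg) (use that in auto)
  define Q where "Q i j = (SOME q. \<forall>\<^sub>F n in sequentially. f n i \<le> q * f n j)" for i j
  have Q: "\<forall>\<^sub>F n in sequentially. f n i \<le> Q i j * f n j" if "i < N" "j < N" for i j
    unfolding Q_def by (rule someI_ex) (use bal[OF that] in \<open>simp add: f_def\<close>)
  define q where "q = 1 + (\<Sum>i<N. \<Sum>j<N. \<bar>Q i j\<bar>)"
  have q1: "q \<ge> 1" by (simp add: q_def sum_nonneg)
  have Qq: "Q i j \<le> q" if "i < N" "j < N" for i j
  proof -
    have "\<bar>Q i j\<bar> \<le> (\<Sum>j<N. \<bar>Q i j\<bar>)" using that by (intro member_le_sum) auto
    also have "\<dots> \<le> (\<Sum>i<N. \<Sum>j<N. \<bar>Q i j\<bar>)"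
      using that by (intro member_le_sum[where f = "\<lambda>i. \<Sum>j<N. \<bar>Q i j\<bar>"]) (auto intro: sum_nonneg)
    finally show ?thesis by (simp add: q_def)
  qed
  have "\<forall>\<^sub>F n in sequentially. \<forall>i\<in>{..<N}. \<forall>j\<in>{..<N}. f n i \<le> Q i j * f n j"
    using Q by (intro eventually_ball_finite ballI) auto
  then obtain n1 where n1: "\<And>n i j. n \<ge> n1 \<Longrightarrow> i < N \<Longrightarrow> j < N \<Longrightarrow> f n i \<le> Q i j * f n j"
    by (auto simp: eventually_sequentially)
  \<comment> \<open>The successor keeps \<open>n0\<close> positive, since roots of every order from
    \<open>n0\<close> on are taken.\<close>
  define n0 where "n0 = Suc n1"
  have cmp: "f n i \<le> q * f n j" if "n \<ge> n0" "i < N" "j < N" for n i j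
  proof -
    have "f n i \<le> Q i j * f n j" using that n1 by (simp add: n0_def)
    also have "\<dots> \<le> q * f n j" using that Qq f_nonneg by (intro mult_right_mono) auto
    finally show ?thesis .
  qed
  define a where "a n = f n 0" for n
  have a_pos: "a n > 0" if "n \<ge> n0" for n
  proof -
    obtain i where "i < N" "f n i > 0" using F_iter_nonzero[OF rho] by (auto simp: f_def)
    then have "0 < q * a n" using cmp[OF that _ N_pos] by (force simp: a_def)
    then show ?thesis using q1 by (simp add: zero_less_mult_iff)
  qed
  have split: "f (n + k) = (F ^^ k) (f n)" for n k
    unfolding f_def by (simp add: add.commute[of n k] funpow_add)
  have up: "a (n + k) \<le> q * (a n * a k)" if "n \<ge> n0" for n k
  proof -
    have "a (n + k) \<le> (F ^^ k) (\<lambda>_. q * a n * 1) 0"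
      unfolding a_def split by (rule F_iter_mono) (use N_pos cmp[OF that _ N_pos] in auto)
    also have "\<dots> = q * a n * a k"
      using q1 a_pos[OF that] by (subst F_iter_scale) (auto simp: a_def f_def)
    finally show ?thesis by simp
  qed
  have lo: "a n * a k \<le> q * a (n + k)" if "n \<ge> n0" for n k
  proof -
    have "a n / q * a k = (F ^^ k) (\<lambda>_. a n / q * 1) 0"
      using q1 a_pos[OF that] by (subst F_iter_scale) (auto simp: a_def f_def)
    also have "\<dots> \<le> a (n + k)"
      unfolding a_def split
    proof (rule F_iter_mono)
      fix j assume "j < N"
      then show "f n 0 / q * 1 \<le> f n j" using cmp[OF that N_pos, of j] q1 by (simp add: field_simps)
    qed (rule N_pos)
    finally show ?thesis using q1 by (simp add: field_simps)
  qed
  obtain r where r: "r > 0" "\<And>n. n \<ge> n0 \<Longrightarrow> r ^ n \<le> q * a n \<and> a n \<le> q * r ^ n"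
    using quasi_multiplicative_growth[of q n0 a] q1 a_pos up lo by (auto simp: n0_def)
  have "\<forall>i<N. 1 / (q * q) * r ^ n \<le> f n i \<and> f n i \<le> q * q * r ^ n" if n: "n \<ge> n0" for n
  proof (intro allI impI conjI)
    fix i assume i: "i < N"
    have "r ^ n \<le> q * a n" using r n by blast
    also have "\<dots> \<le> q * (q * f n i)"
      using cmp[OF n N_pos i] q1 by (intro mult_left_mono) (auto simp: a_def)
    finally show "1 / (q * q) * r ^ n \<le> f n i" using q1 by (simp add: field_simps)
    have "f n i \<le> q * a n" using cmp[OF n i N_pos] by (simp add: a_def)
    also have "\<dots> \<le> q * (q * r ^ n)" using r n q1 by (intro mult_left_mono) auto
    finally show "f n i \<le> q * q * r ^ n" by simp
  qed
  then have "\<forall>\<^sub>F n in sequentially. \<forall>i<N. 1 / (q * q) * r ^ n \<le> f n i \<and> f n i \<le> q * q * r ^ n"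
    by (auto simp: eventually_sequentially)
  moreover have "1 / (q * q) > 0" using q1 by simp
  ultimately show ?thesis using r(1) unfolding f_def by blast
qed

end

section \<open>Uniform constants over finitely many components\<close>

lemma common_bound:
  assumes "\<And>i. i < (N::nat) \<Longrightarrow> \<forall>\<^sub>F n in sequentially. f n i \<le> Q i * g n i"
    and "\<And>n i. i < N \<Longrightarrow> (0::real) \<le> g n i"
  shows "\<exists>q>0. \<forall>\<^sub>F n in sequentially. \<forall>i<N. f n i \<le> q * g n i"
proof -
  define q where "q = 1 + (\<Sum>i<N. \<bar>Q i\<bar>)"
  have Qq: "Q i \<le> q" if "i < N" for i
  proof -
    have "\<bar>Q i\<bar> \<le> (\<Sum>i<N. \<bar>Q i\<bar>)" using that by (intro member_le_sum) auto
    then show ?thesis by (simp add: q_def)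
  qed
  have "\<forall>\<^sub>F n in sequentially. \<forall>i\<in>{..<N}. f n i \<le> Q i * g n i"
    using assms(1) by (intro eventually_ball_finite ballI) auto
  then have "\<forall>\<^sub>F n in sequentially. \<forall>i<N. f n i \<le> q * g n i"
  proof eventually_elim
    case (elim n)
    show ?case
    proof (intro allI impI)
      fix i assume i: "i < N"
      then have "f n i \<le> Q i * g n i" using elim by simp
      also have "\<dots> \<le> q * g n i" using assms(2)[OF i] Qq[OF i] by (intro mult_right_mono)
      finally show "f n i \<le> q * g n i" .
    qed
  qed
  moreover have "q > 0" by (simp add: q_def add_pos_nonneg sum_nonneg)
  ultimately show ?thesis by blast
qed

lemma pos_functions_comparable:
  assumes "\<And>i. i < (N::nat) \<Longrightarrow> 0 < (w i :: real)"
  shows "\<exists>\<beta>>0. \<forall>i<N. v i \<le> \<beta> * w i"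
proof -
  \<comment> \<open>Viewed as sequences constant in \<open>n\<close>, the two functions fall under
    \<open>common_bound\<close>.\<close>
  have "\<forall>\<^sub>F n in sequentially. v i \<le> v i / w i * w i" if "i < N" for i
    using assms[OF that] by simp
  then have "\<exists>q>0. \<forall>\<^sub>F n::nat in sequentially. \<forall>i<N. v i \<le> q * w i"
    by (rule common_bound) (use assms in \<open>auto simp: less_imp_le\<close>)
  then show ?thesis by (simp add: eventually_const)
qed

context product_family
begin

lemma ap_iter_nonneg:
  assumes "A \<in> K" "i < N" "\<And>j. j < N \<Longrightarrow> 0 \<le> x j"
  shows "0 \<le> (ap A ^^ n) x i"
  using F_iter_nonneg[of i x n] F_iter_le_ap_iter[of A i n x] assms by auto

text \<open>If the decreasing limit \<open>u\<close> of \<open>F\<^sup>n v / r\<^sup>n\<close> vanished on a set \<open>Z \<noteq> {}\<close>, the rows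
  in \<open>Z\<close> that are greedy late in the iteration would have no entries outside \<open>Z\<close>, and a suitable
  choice of them (at the minimum defining \<open>x\<close> below) would give a single matrix of the family
  contracting on \<open>Z\<close> at a rate below \<open>r\<close>.\<close>

lemma pos_eigenvector_of_dominated:
  assumes r: "r > 0" and v: "\<And>i. i < N \<Longrightarrow> 0 < v i"
    and Fv: "\<And>i. i < N \<Longrightarrow> F v i \<le> r * v i"
    and dom: "\<And>A. A \<in> K \<Longrightarrow> \<exists>c>0. \<forall>\<^sub>F n in sequentially. \<forall>i<N. c * r ^ n \<le> (ap A ^^ n) v i"
  obtains u where "\<And>i. i < N \<Longrightarrow> 0 < u i" "\<And>i. i < N \<Longrightarrow> F u i = r * u i"
proof -
  have v0: "0 \<le> v i" if "i < N" for i using v[OF that] by simp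
  obtain u where u: "\<And>i. i < N \<Longrightarrow> 0 \<le> u i" "\<And>i. i < N \<Longrightarrow> F u i = r * u i"
    "\<And>i. i < N \<Longrightarrow> (\<lambda>n. (F ^^ n) v i / r ^ n) \<longlonglongrightarrow> u i"
    "\<And>n i. i < N \<Longrightarrow> u i \<le> (F ^^ n) v i / r ^ n"
  proof (rule supersolution_limit[of r v "\<lambda>_. 0"])
    show "0 * r ^ n \<le> (F ^^ n) v i" if "i < N" for n i
      using F_iter_nonneg[OF that v0] by simp
  qed (use r Fv in auto)
  define Z where "Z = {i. i < N \<and> u i = 0}"
  show thesis
  proof (cases "Z = {}")
    case True
    then have "0 < u i" if "i < N" for i using u(1)[OF that] that by (force simp: Z_def)
    then show thesis using that u(2) by blast
  next
    case False
    then obtain i0 where i0: "i0 \<in> Z" by auto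
    have Z: "finite Z" "\<And>i. i \<in> Z \<Longrightarrow> i < N" by (auto simp: Z_def)
    \<comment> \<open>A zero row would make that component of the member's orbit vanish, contrary to
      \<open>dom\<close>. So every row of every member has a positive entry.\<close>
    have F_pos: "0 < F x i" if i: "i < N" and x: "\<And>j. j < N \<Longrightarrow> 0 < x j" for x i
    proof -
      obtain A where A: "A \<in> K" "F x i = ap A x i" using F_attained by blast
      obtain c where c: "c > 0" "\<forall>\<^sub>F n in sequentially. \<forall>i<N. c * r ^ n \<le> (ap A ^^ n) v i"
        using dom[OF A(1)] by blast
      obtain n where n: "n \<ge> 1" "c * r ^ n \<le> (ap A ^^ n) v i"
        using eventually_conj[OF c(2) eventually_ge_at_top[of 1]] i
        by (auto simp: eventually_sequentially)
      obtain n' where n': "n = Suc n'" using n by (cases n) auto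
      have "0 < c * r ^ n" using c r by simp
      then have "0 < ap A ((ap A ^^ n') v) i" using n n' by simp
      moreover have "ap A ((ap A ^^ n') v) i \<le> 0"
        if nx: "\<not> (\<exists>j<N. A $$ (i, j) * (ap A ^^ n') v j > 0)"
        unfolding mat_app_def[of N A "(ap A ^^ n') v"]
      proof (rule sum_nonpos)
        fix j assume "j \<in> {..<N}"
        then show "A $$ (i, j) * (ap A ^^ n') v j \<le> 0" using nx by (meson lessThan_iff not_le)
      qed
      ultimately have "\<exists>j<N. A $$ (i, j) * (ap A ^^ n') v j > 0" by fastforce
      then obtain j where j: "j < N" "A $$ (i, j) \<noteq> 0" by (metis less_irrefl mult_zero_left)
      have "0 < A $$ (i, j) * x j" using j nonneg[OF A(1) i j(1)] x[OF j(1)] by simp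
      also have "\<dots> \<le> ap A x i"
        unfolding mat_app_def using j nonneg[OF A(1) i] x
        by (intro member_le_sum[where f = "\<lambda>j. A $$ (i, j) * x j"]) (auto simp: less_imp_le)
      finally show ?thesis using A by simp
    qed
    define y where "y n i = (F ^^ n) v i / r ^ n" for n i
    have y_pos: "0 < y n i" if "i < N" for n i
    proof -
      have "0 < (F ^^ n) v i" using that by (induction n arbitrary: i) (auto intro!: F_pos v)
      then show ?thesis using r by (simp add: y_def)
    qed
    have Fy: "F (y n) i = r * y (Suc n) i" for n i
    proof -
      have y_eq: "y n = (\<lambda>j. (1 / r ^ n) * (F ^^ n) v j)" by (auto simp: y_def)
      have "F (y n) i = (1 / r ^ n) * F ((F ^^ n) v) i"
        unfolding y_eq by (rule F_scale) (use r in simp)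
      then show ?thesis using r by (simp add: y_def)
    qed
    have y_lim: "(\<lambda>n. y n i) \<longlonglongrightarrow> 0" if "i \<in> Z" for i
      using u(3)[of i] that by (simp add: y_def Z_def)
    have u_le: "u i \<le> y n i" if "i < N" for n i
      using u(4)[OF that] by (simp add: y_def)
    \<comment> \<open>\<open>\<delta>\<close> is a positive lower bound for all positive products of
      an entry with a component of \<open>u\<close>. Once \<open>r * y (Suc n) i < \<delta>\<close>
      on \<open>Z\<close>, a greedy row in \<open>Z\<close> has no room for an entry leading outside
      \<open>Z\<close>. The extra element 1 guards against an empty \<open>W\<close>.\<close>
    define W where "W = {A $$ (i, j) * u j | A i j. A \<in> K \<and> i < N \<and> j < N \<and> 0 < A $$ (i, j) * u j}"
    have "finite W"
    proof (rule finite_subset)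
      show "W \<subseteq> (\<lambda>(A, i, j). A $$ (i, j) * u j) ` (K \<times> {..<N} \<times> {..<N})"
        by (force simp: W_def)
    qed (use finite_K in auto)
    define \<delta> where "\<delta> = Min (insert 1 W)"
    have \<delta>: "\<delta> > 0" "\<And>w. w \<in> W \<Longrightarrow> \<delta> \<le> w"
      using \<open>finite W\<close> by (auto simp: \<delta>_def W_def)
    have "\<forall>\<^sub>F n in sequentially. \<forall>i\<in>Z. y n i < \<delta> / r"
    proof (intro eventually_ball_finite ballI Z)
      fix i assume "i \<in> Z"
      then show "\<forall>\<^sub>F n in sequentially. y n i < \<delta> / r"
        using order_tendstoD(2)[OF y_lim, of i "\<delta> / r"] \<delta> r by simp
    qed
    then obtain n0 where n0: "\<And>n i. n \<ge> n0 \<Longrightarrow> i \<in> Z \<Longrightarrow> y n i < \<delta> / r"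
      by (auto simp: eventually_sequentially)
    have closed: "A $$ (i, j) = 0"
      if A: "A \<in> K" and i: "i \<in> Z" and j: "j < N" "j \<notin> Z" and n: "n \<ge> n0"
        and att: "ap A (y n) i = F (y n) i" for A i j n
    proof (rule ccontr)
      assume nz: "A $$ (i, j) \<noteq> 0"
      have "0 < u j" using u(1)[OF j(1)] j by (auto simp: Z_def)
      then have "A $$ (i, j) * u j \<in> W"
        using nz nonneg[OF A Z(2)[OF i] j(1)] A Z(2)[OF i] j unfolding W_def
        by (intro CollectI exI[of _ A] exI[of _ i] exI[of _ j]) auto
      then have "\<delta> \<le> A $$ (i, j) * u j" by (rule \<delta>)
      also have "\<dots> \<le> A $$ (i, j) * y n j"
        using nonneg[OF A Z(2)[OF i] j(1)] u_le[OF j(1)] by (intro mult_left_mono)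
      also have "\<dots> \<le> ap A (y n) i"
        unfolding mat_app_def using j nonneg[OF A Z(2)[OF i]] y_pos
        by (intro member_le_sum[where f = "\<lambda>j. A $$ (i, j) * y n j"]) (auto simp: less_imp_le)
      also have "\<dots> = r * y (Suc n) i" by (simp add: att Fy)
      also have "\<dots> < \<delta>" using n0[of "Suc n" i] n i r by (simp add: field_simps)
      finally show False by simp
    qed
    have "\<forall>\<^sub>F n in sequentially. \<forall>i\<in>Z. y (n + n0) i < y n0 i / 2"
    proof (intro eventually_ball_finite ballI Z)
      fix i assume i: "i \<in> Z"
      show "\<forall>\<^sub>F n in sequentially. y (n + n0) i < y n0 i / 2"
        by (rule order_tendstoD(2)[OF LIMSEQ_ignore_initial_segment[OF y_lim[OF i]]])
          (use y_pos Z i in simp)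
    qed
    then obtain M where M: "\<And>n. n \<ge> M \<Longrightarrow> \<forall>i\<in>Z. y (n + n0) i < y n0 i / 2"
      unfolding eventually_sequentially by blast
    define m where "m = Suc M"
    have m: "0 < m" "\<And>i. i \<in> Z \<Longrightarrow> y (m + n0) i < y n0 i / 2"
      using M[of m] by (auto simp: m_def)
    \<comment> \<open>On \<open>Z\<close>, \<open>m\<close> steps at least halve \<open>y\<close>,
      so \<open>t < 1\<close> is an average rate of decay per step.\<close>
    define t where "t = root m (1 / 2)"
    have t: "0 < t" "t < 1" "t ^ m = 1 / 2"
      using m by (auto simp: t_def real_root_gt_zero real_root_pow_pos2)
    define g where "g i k = y (n0 + k) i / t ^ k" for i k
    define x where "x i = Min (g i ` {..<m})" for i
    have x_le: "x i \<le> g i k" if "k < m" for i k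
      unfolding x_def using that by (intro Min_le) auto
    \<comment> \<open>The minimum over the window can be taken at a positive time: if it sits at 0,
      the halving makes time \<open>m\<close> at least as good. A predecessor
      \<open>\<kappa> i - 1 < m\<close> is therefore available, and row \<open>i\<close> is chosen
      greedy there.\<close>
    have "\<exists>k. 1 \<le> k \<and> k \<le> m \<and> g i k \<le> x i" if i: "i \<in> Z" for i
    proof -
      have "x i \<in> g i ` {..<m}" unfolding x_def using m by (intro Min_in) (auto simp: lessThan_empty_iff)
      then obtain k where k: "k < m" "x i = g i k" by auto
      show ?thesis
      proof (cases "k = 0")
        case True
        have "g i m \<le> g i 0" using m(2)[OF i] by (simp add: g_def t(3) add.commute)
        then show ?thesis using True k m by (intro exI[of _ m]) auto
      next
        case False
        then show ?thesis using k by (intro exI[of _ k]) auto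
      qed
    qed
    then have "\<exists>\<kappa>. \<forall>i\<in>Z. 1 \<le> \<kappa> i \<and> \<kappa> i \<le> m \<and> g i (\<kappa> i) \<le> x i"
      by (intro bchoice ballI)
    then obtain \<kappa> where \<kappa>: "\<And>i. i \<in> Z \<Longrightarrow> 1 \<le> \<kappa> i \<and> \<kappa> i \<le> m \<and> g i (\<kappa> i) \<le> x i" by blast
    obtain A where A: "A \<in> K"
        "\<forall>i<N. ap A (y (n0 + (\<kappa> i - 1))) i = F (y (n0 + (\<kappa> i - 1))) i"
      using greedy_selection[of "\<lambda>i. y (n0 + (\<kappa> i - 1))"] by blast
    have A0: "A $$ (i, j) = 0" if "i \<in> Z" "j < N" "j \<notin> Z" for i j
      by (rule closed[OF A(1) that, of "n0 + (\<kappa> i - 1)"]) (use A Z that in auto)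
    \<comment> \<open>For row \<open>i\<close>, all \<open>x j\<close> are bounded by
      \<open>g j k\<close> at the one time \<open>k = \<kappa> i - 1\<close>. A greedy step from
      there reaches time \<open>\<kappa> i\<close>, where \<open>g i\<close> is minimal, and the
      weight \<open>t ^ k\<close> turns into the extra factor \<open>t\<close>.\<close>
    have contract: "(\<Sum>j<N. A $$ (i, j) * x j) \<le> r * t * x i" if i: "i \<in> Z" for i
    proof -
      define k where "k = \<kappa> i - 1"
      have k: "\<kappa> i = Suc k" "k < m" using \<kappa>[OF i] by (auto simp: k_def)
      have "(\<Sum>j<N. A $$ (i, j) * x j) \<le> (\<Sum>j<N. A $$ (i, j) * g j k)"
        using nonneg[OF A(1) Z(2)[OF i]] x_le[OF k(2)] by (intro sum_mono mult_left_mono) auto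
      also have "\<dots> = ap A (y (n0 + k)) i / t ^ k"
        by (simp add: mat_app_def g_def sum_divide_distrib)
      also have "ap A (y (n0 + k)) i = r * y (n0 + Suc k) i"
        using A(2) Z(2)[OF i] by (simp add: k_def Fy)
      also have "r * y (n0 + Suc k) i / t ^ k = r * t * g i (\<kappa> i)"
        using t by (simp add: g_def k)
      also have "\<dots> \<le> r * t * x i" using \<kappa>[OF i] r t by (intro mult_left_mono) auto
      finally show ?thesis .
    qed
    have x_pos: "0 < x i" if "i < N" for i
      unfolding x_def using m y_pos[OF that] t by (subst Min_gr_iff) (auto simp: g_def lessThan_empty_iff)
    obtain Q where Q: "Q > 0" "\<forall>i<N. v i \<le> Q * x i"
      using pos_functions_comparable[of N x v] x_pos by blast
    have bound: "(ap A ^^ n) v i \<le> Q * (r * t) ^ n * x i" if "i \<in> Z" for n i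
      using that
    proof (induction n arbitrary: i)
      case 0
      then show ?case using Q Z by simp
    next
      case (Suc n)
      have "(ap A ^^ Suc n) v i = (\<Sum>j<N. A $$ (i, j) * (ap A ^^ n) v j)" by (simp add: mat_app_def)
      also have "\<dots> \<le> (\<Sum>j<N. A $$ (i, j) * (Q * (r * t) ^ n * x j))"
      proof (rule sum_mono)
        fix j assume "j \<in> {..<N}"
        then have j: "j < N" by simp
        show "A $$ (i, j) * (ap A ^^ n) v j \<le> A $$ (i, j) * (Q * (r * t) ^ n * x j)"
        proof (cases "j \<in> Z")
          case True
          then show ?thesis
            using Suc.IH[OF True] nonneg[OF A(1) Z(2)[OF Suc.prems] j] by (intro mult_left_mono)
        next
          case False
          then show ?thesis using A0[OF Suc.prems j] by simp
        qed
      qed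
      also have "\<dots> = Q * (r * t) ^ n * (\<Sum>j<N. A $$ (i, j) * x j)"
        by (simp add: sum_distrib_left algebra_simps)
      also have "\<dots> \<le> Q * (r * t) ^ n * (r * t * x i)"
        using contract[OF Suc.prems] Q r t by (intro mult_left_mono) auto
      finally show ?case by (simp add: mult.assoc mult.left_commute)
    qed
    obtain c where c: "c > 0" "\<forall>\<^sub>F n in sequentially. \<forall>i<N. c * r ^ n \<le> (ap A ^^ n) v i"
      using dom[OF A(1)] by blast
    have "(\<lambda>n. Q * x i0 * t ^ n) \<longlonglongrightarrow> Q * x i0 * 0"
      by (intro tendsto_mult tendsto_const LIMSEQ_realpow_zero) (use t in auto)
    then have "\<forall>\<^sub>F n in sequentially. Q * x i0 * t ^ n < c"
      using c(1) by (intro order_tendstoD(2)) auto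
    then have "\<forall>\<^sub>F n in sequentially. False"
      using c(2)
    proof eventually_elim
      case (elim n)
      have "c * r ^ n \<le> Q * (r * t) ^ n * x i0"
        using elim bound[OF i0, of n] Z(2)[OF i0] by fastforce
      then have "c * r ^ n \<le> (Q * x i0 * t ^ n) * r ^ n" by (simp add: power_mult_distrib algebra_simps)
      then have "c \<le> Q * x i0 * t ^ n" using r by simp
      then show ?case using elim by simp
    qed
    then show thesis by simp
  qed
qed

subsection \<open>Existence of minimal matrices\<close>

text \<open>The constant vector 1 stands for all strictly positive vectors, which are comparable
  with it up to constants; \<open>growth_minimal_iff\<close> links this to minimality.\<close>

definition growth_dom :: "real mat \<Rightarrow> real mat \<Rightarrow> bool" where
  "growth_dom B A \<longleftrightarrow> (\<exists>q>0. \<forall>\<^sub>F n in sequentially. \<forall>i<N.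
     (ap B ^^ n) (\<lambda>_. 1) i \<le> q * (ap A ^^ n) (\<lambda>_. 1) i)"

lemma growth_dom_trans:
  assumes "growth_dom A B" "growth_dom B C"
  shows "growth_dom A C"
proof -
  obtain p q where p: "p > 0" "\<forall>\<^sub>F n in sequentially. \<forall>i<N. (ap A ^^ n) (\<lambda>_. 1) i \<le> p * (ap B ^^ n) (\<lambda>_. 1) i"
    and q: "q > 0" "\<forall>\<^sub>F n in sequentially. \<forall>i<N. (ap B ^^ n) (\<lambda>_. 1) i \<le> q * (ap C ^^ n) (\<lambda>_. 1) i"
    using assms unfolding growth_dom_def by auto
  have "\<forall>\<^sub>F n in sequentially. \<forall>i<N. (ap A ^^ n) (\<lambda>_. 1) i \<le> p * q * (ap C ^^ n) (\<lambda>_. 1) i"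
    using p(2) q(2)
  proof eventually_elim
    case (elim n)
    show ?case
    proof (intro allI impI)
      fix i assume i: "i < N"
      have "(ap A ^^ n) (\<lambda>_. 1) i \<le> p * (ap B ^^ n) (\<lambda>_. 1) i" using elim i by blast
      also have "\<dots> \<le> p * (q * (ap C ^^ n) (\<lambda>_. 1) i)"
        using elim i p by (intro mult_left_mono) auto
      finally show "(ap A ^^ n) (\<lambda>_. 1) i \<le> p * q * (ap C ^^ n) (\<lambda>_. 1) i" by simp
    qed
  qed
  then show ?thesis unfolding growth_dom_def using p(1) q(1) by (intro exI[of _ "p * q"]) auto
qed

lemma ap_iter_zero_mono:
  assumes A: "A \<in> K" and i: "i < N" and "(ap A ^^ n) (\<lambda>_. 1) i = 0" and "m \<ge> n"
  shows "(ap A ^^ m) (\<lambda>_. 1) i = 0"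
proof -
  obtain C where C: "C > 0" "\<And>n. (ap A ^^ Suc n) (\<lambda>_. 1) i \<le> C * (ap A ^^ n) (\<lambda>_. 1) i"
    using power_exp_growth_mat_app(2)[OF carrier[OF A] nonneg[OF A], of "\<lambda>_. 1" i] i by auto
  show ?thesis using assms(4)
  proof (induction m rule: dec_induct)
    case (step m)
    have "(ap A ^^ Suc m) (\<lambda>_. 1) i \<le> 0" using C(2)[of m] step by simp
    moreover have "0 \<le> (ap A ^^ Suc m) (\<lambda>_. 1) i" by (rule ap_iter_nonneg) (use A i in auto)
    ultimately show ?case by simp
  qed (rule assms(3))
qed

lemma ap_iter_zero_row:
  assumes A: "A \<in> K" and i: "i < N" and j: "j < N" "A $$ (i, j) \<noteq> 0"
    and z: "(ap A ^^ Suc n) (\<lambda>_. 1) i = 0"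
  shows "(ap A ^^ n) (\<lambda>_. 1) j = 0"
proof -
  have "(\<Sum>j<N. A $$ (i, j) * (ap A ^^ n) (\<lambda>_. 1) j) = 0" using z by (simp add: mat_app_def)
  then have "\<forall>j\<in>{..<N}. A $$ (i, j) * (ap A ^^ n) (\<lambda>_. 1) j = 0"
    using ap_iter_nonneg[OF A, of _ "\<lambda>_. 1" n] nonneg[OF A i]
    by (subst (asm) sum_nonneg_eq_0_iff) auto
  then show ?thesis using j by auto
qed

text \<open>The rows of \<open>C\<close> come from \<open>A\<close> where \<open>A\<close> grows at most as fast as \<open>B\<close>, and from \<open>B\<close>
  elsewhere. Shrinking the orbit of \<open>A\<close> by \<open>1 / q\<close> makes \<open>h\<close>, the orbit put together from the two in
  the same way, a lower bound of both, so that \<open>C (h n) \<le> h (Suc n)\<close> without any constant. Components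
  where \<open>h\<close> is eventually \<open>0\<close> have to be treated beforehand, as no multiple of \<open>h\<close> dominates there.\<close>

lemma common_growth_minorant:
  assumes A: "A \<in> K" and B: "B \<in> K"
  shows "\<exists>C\<in>K. growth_dom C A \<and> growth_dom C B"
proof -
  let ?o = "\<lambda>_. 1 :: real"
  define a where "a n i = (ap A ^^ n) ?o i" for n i
  define b where "b n i = (ap B ^^ n) ?o i" for n i
  have a0: "0 \<le> a n i" if "i < N" for n i
    unfolding a_def by (rule ap_iter_nonneg) (use A that in auto)
  have b0: "0 \<le> b n i" if "i < N" for n i
    unfolding b_def by (rule ap_iter_nonneg) (use B that in auto)
  have a_Suc: "a (Suc n) i = ap A (a n) i" for n i by (simp add: a_def[abs_def])
  have b_Suc: "b (Suc n) i = ap B (b n) i" for n i by (simp add: b_def[abs_def])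
  define V where "V = {i. i < N \<and> (\<exists>q>0. \<forall>\<^sub>F n in sequentially. a n i \<le> q * b n i)}"
  have notV: "\<forall>\<^sub>F n in sequentially. b n i \<le> e * a n i" if "i < N" "i \<notin> V" "e > 0" for i e
  proof -
    have "power_exp_growth (\<lambda>n. a n i)"
      unfolding a_def by (rule power_exp_growth_mat_app(1)[OF carrier[OF A] nonneg[OF A]]) (use that in auto)
    moreover have "power_exp_growth (\<lambda>n. b n i)"
      unfolding b_def by (rule power_exp_growth_mat_app(1)[OF carrier[OF B] nonneg[OF B]]) (use that in auto)
    ultimately show ?thesis
      using power_exp_growth_dichotomy[of "\<lambda>n. a n i" "\<lambda>n. b n i"] a0 b0 that by (auto simp: V_def)
  qed
  \<comment> \<open>The default 0 is a valid constant outside \<open>V\<close>, where the truncated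
    sequence below is 0.\<close>
  define Q where "Q i = (if i \<in> V then SOME q. \<forall>\<^sub>F n in sequentially. a n i \<le> q * b n i else 0)" for i
  have "\<forall>\<^sub>F n in sequentially. a n i \<le> Q i * b n i" if "i \<in> V" for i
  proof -
    have "\<exists>q. \<forall>\<^sub>F n in sequentially. a n i \<le> q * b n i" using that by (auto simp: V_def)
    then have "\<forall>\<^sub>F n in sequentially. a n i \<le> (SOME q. \<forall>\<^sub>F n in sequentially. a n i \<le> q * b n i) * b n i"
      by (rule someI_ex)
    then show ?thesis using that by (simp add: Q_def)
  qed
  then have "\<exists>q>0. \<forall>\<^sub>F n in sequentially. \<forall>i<N. (if i \<in> V then a n i else 0) \<le> q * b n i"
    using b0 by (intro common_bound[of N _ Q]) (auto simp: Q_def)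
  then obtain q where q: "q > 0"
      "\<forall>\<^sub>F n in sequentially. \<forall>i<N. (if i \<in> V then a n i else 0) \<le> q * b n i" by auto
  \<comment> \<open>Negligibility outside \<open>V\<close> is used with exactly
    \<open>1 / q\<close>, the factor that scales \<open>a\<close> on \<open>V\<close>. So
    \<open>h\<close> lies below both \<open>a / q\<close> and \<open>b\<close> in all
    components.\<close>
  have "\<forall>\<^sub>F n in sequentially. \<forall>i\<in>{..<N} - V. b n i \<le> 1 / q * a n i"
    using notV[of _ "1 / q"] q by (intro eventually_ball_finite ballI) auto
  with q(2) have "\<forall>\<^sub>F n in sequentially. (\<forall>i<N. (if i \<in> V then a n i else 0) \<le> q * b n i) \<and>
      (\<forall>i\<in>{..<N} - V. b n i \<le> 1 / q * a n i)" by (rule eventually_conj)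
  then obtain n1 where ev: "\<And>n. n \<ge> n1 \<Longrightarrow> (\<forall>i<N. (if i \<in> V then a n i else 0) \<le> q * b n i) \<and>
      (\<forall>i\<in>{..<N} - V. b n i \<le> 1 / q * a n i)"
    unfolding eventually_sequentially by blast
  have n1: "n \<ge> n1 \<Longrightarrow> i \<in> V \<Longrightarrow> a n i \<le> q * b n i"
      "n \<ge> n1 \<Longrightarrow> i < N \<Longrightarrow> i \<notin> V \<Longrightarrow> b n i \<le> 1 / q * a n i" for n i
    using ev[of n] by (auto simp: V_def split: if_splits)
  define h where "h n i = (if i \<in> V then 1 / q * a n i else b n i)" for n i
  have ha: "h n i \<le> 1 / q * a n i" if "n \<ge> n1" "i < N" for n i
    using n1(2)[OF that] by (simp add: h_def)
  have hb: "h n i \<le> b n i" if "n \<ge> n1" for n i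
    using n1(1)[OF that, of i] q(1) by (simp add: h_def field_simps)
  have "(if i \<in> V then A else B) \<in> K" for i using A B by simp
  then obtain C where C: "C \<in> K" "\<forall>i<N. \<forall>j<N. C $$ (i, j) = (if i \<in> V then A else B) $$ (i, j)"
    using row_selection[of "\<lambda>i. if i \<in> V then A else B"] by blast
  have CA: "ap C x i = ap A x i" if "i < N" "i \<in> V" for x i
    using C(2) that by (simp add: mat_app_def)
  have CB: "ap C x i = ap B x i" if "i < N" "i \<notin> V" for x i
    using C(2) that by (simp add: mat_app_def)
  have Ch: "ap C (h n) i \<le> h (Suc n) i" if n: "n \<ge> n1" and i: "i < N" for n i
  proof (cases "i \<in> V")
    case True
    have "ap C (h n) i \<le> ap A (\<lambda>j. 1 / q * a n j) i"
      unfolding CA[OF i True] by (rule mat_app_mono) (use nonneg[OF A i] ha[OF n] in auto)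
    also have "\<dots> = h (Suc n) i" unfolding mat_app_scale using True by (simp add: h_def a_Suc)
    finally show ?thesis .
  next
    case False
    have "ap C (h n) i \<le> ap B (b n) i"
      unfolding CB[OF i False] by (rule mat_app_mono) (use nonneg[OF B i] hb[OF n] in auto)
    also have "\<dots> = h (Suc n) i" using False by (simp add: h_def b_Suc)
    finally show ?thesis .
  qed
  define c where "c n i = (ap C ^^ n) ?o i" for n i
  have c0: "0 \<le> c n i" if "i < N" for n i
    unfolding c_def by (rule ap_iter_nonneg) (use C that in auto)
  have c_Suc: "c (Suc n) i = ap C (c n) i" for n i by (simp add: c_def[abs_def])
  define za where "za i \<longleftrightarrow> (\<exists>n. a n i = 0)" for i
  define zb where "zb i \<longleftrightarrow> (\<exists>n. b n i = 0)" for i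
  have za_ev: "\<forall>\<^sub>F n in sequentially. a n i = 0" if "za i" "i < N" for i
    using that ap_iter_zero_mono[OF A] unfolding za_def a_def eventually_sequentially by blast
  have zb_ev: "\<forall>\<^sub>F n in sequentially. b n i = 0" if "zb i" "i < N" for i
    using that ap_iter_zero_mono[OF B] unfolding zb_def b_def eventually_sequentially by blast
  have za_V: "i \<in> V" if "za i" "i < N" for i
  proof -
    have "\<forall>\<^sub>F n in sequentially. a n i \<le> 1 * b n i"
      using za_ev[OF that] by eventually_elim (use b0 that in simp)
    then show ?thesis unfolding V_def using that(2) by (intro CollectI conjI exI[of _ 1]) auto
  qed
  have za_row: "za j" if "za i" "i < N" "j < N" "A $$ (i, j) \<noteq> 0" for i j
  proof -
    obtain n where "a n i = 0" using \<open>za i\<close> by (auto simp: za_def)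
    then have "a (Suc n) i = 0" 
      unfolding a_def by (rule ap_iter_zero_mono[OF A that(2)]) simp
    then have "a n j = 0" unfolding a_def by (rule ap_iter_zero_row[OF A that(2-4)])
    then show ?thesis by (auto simp: za_def)
  qed
  have zb_row: "zb j" if "zb i" "i < N" "j < N" "B $$ (i, j) \<noteq> 0" for i j
  proof -
    obtain n where "b n i = 0" using \<open>zb i\<close> by (auto simp: zb_def)
    then have "b (Suc n) i = 0" 
      unfolding b_def by (rule ap_iter_zero_mono[OF B that(2)]) simp
    then have "b n j = 0" unfolding b_def by (rule ap_iter_zero_row[OF B that(2-4)])
    then show ?thesis by (auto simp: zb_def)
  qed
  have za_of_zb: "za j" if "zb j" "j \<in> V" for j
  proof -
    have j: "j < N" using that by (simp add: V_def)
    obtain m where "\<And>n. n \<ge> m \<Longrightarrow> b n j = 0"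
      using zb_ev[OF \<open>zb j\<close> j] unfolding eventually_sequentially by blast
    then obtain n where n: "n \<ge> n1" "b n j = 0" by (meson max.cobounded1 max.cobounded2)
    then have "a n j = 0" using n1(1)[OF n(1) that(2)] a0[OF j, of n] by simp
    then show ?thesis by (auto simp: za_def)
  qed
  have "\<forall>\<^sub>F n in sequentially. \<forall>i\<in>{..<N}. (za i \<longrightarrow> a n i = 0) \<and> (zb i \<longrightarrow> b n i = 0)"
  proof (intro eventually_ball_finite ballI eventually_conj)
    fix i assume "i \<in> {..<N}"
    then show "\<forall>\<^sub>F n in sequentially. za i \<longrightarrow> a n i = 0" "\<forall>\<^sub>F n in sequentially. zb i \<longrightarrow> b n i = 0"
      using za_ev[of i] zb_ev[of i] by (cases "za i"; cases "zb i"; simp)+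
  qed simp
  then obtain n2 where n2: "\<And>n i. n \<ge> n2 \<Longrightarrow> i < N \<Longrightarrow> za i \<Longrightarrow> a n i = 0"
      "\<And>n i. n \<ge> n2 \<Longrightarrow> i < N \<Longrightarrow> zb i \<Longrightarrow> b n i = 0"
    by (auto simp: eventually_sequentially)
  \<comment> \<open>Rows of \<open>A\<close> at vanishing components lead only to vanishing
    components. All of these lie in \<open>V\<close>, so \<open>C\<close> acts on them as
    \<open>A\<close> does.\<close>
  have c_za: "c n i = a n i" if "i < N" "za i" for n i
    using that
  proof (induction n arbitrary: i)
    case (Suc n)
    have "ap C (c n) i = ap A (c n) i" using CA za_V Suc.prems by simp
    also have "\<dots> = ap A (a n) i"
      unfolding mat_app_def
    proof (rule sum.cong)
      fix j assume "j \<in> {..<N}"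
      then show "A $$ (i, j) * c n j = A $$ (i, j) * a n j"
        using za_row[OF Suc.prems(2,1), of j] Suc.IH[of j] by (cases "A $$ (i, j) = 0") auto
    qed simp
    finally show ?case by (simp add: c_Suc a_Suc)
  qed (simp add: c_def a_def)
  obtain R where R: "R > 0" "\<forall>i<N. c n2 i \<le> R * 1"
    using pos_functions_comparable[of N ?o "c n2"] by auto
  \<comment> \<open>From time \<open>n2\<close> on, neighbours in \<open>V\<close> contribute
    nothing, because there vanishing of \<open>b\<close> forces vanishing of \<open>a\<close> and
    hence of \<open>c\<close>. The other neighbours are covered by the induction, and
    \<open>R\<close> absorbs the values at time \<open>n2\<close>.\<close>
  have c_zb: "c (n2 + n) i \<le> R * b n i" if "i < N" "i \<notin> V" "zb i" for n i
    using that
  proof (induction n arbitrary: i)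
    case 0
    then show ?case using R by (simp add: b_def)
  next
    case (Suc n)
    have "ap C (c (n2 + n)) i = (\<Sum>j<N. B $$ (i, j) * c (n2 + n) j)"
      using CB Suc.prems by (simp add: mat_app_def)
    also have "\<dots> \<le> (\<Sum>j<N. B $$ (i, j) * (R * b n j))"
    proof (rule sum_mono)
      fix j assume "j \<in> {..<N}"
      then have j: "j < N" by simp
      show "B $$ (i, j) * c (n2 + n) j \<le> B $$ (i, j) * (R * b n j)"
      proof (cases "B $$ (i, j) = 0")
        case False
        then have zbj: "zb j" using zb_row Suc.prems j by blast
        have "c (n2 + n) j \<le> R * b n j"
        proof (cases "j \<in> V")
          case True
          then have "c (n2 + n) j = 0" using za_of_zb[OF zbj] c_za[OF j] n2(1)[OF _ j] by simp
          then show ?thesis using R b0[OF j] by simp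
        qed (use Suc.IH[OF j _ zbj] in simp)
        then show ?thesis using nonneg[OF B Suc.prems(1) j] by (intro mult_left_mono)
      qed simp
    qed
    also have "\<dots> = R * b (Suc n) i" by (simp add: b_Suc mat_app_def sum_distrib_left algebra_simps)
    finally show ?case by (simp add: c_Suc)
  qed
  \<comment> \<open>\<open>n2\<close> enters twice: \<open>c_zb\<close> compares \<open>c\<close>
    with \<open>b\<close> delayed by \<open>n2\<close>, and the delayed \<open>b\<close> must itself
    have passed \<open>n2\<close> to be 0.\<close>
  define n3 where "n3 = n1 + n2 + n2"
  define S where "S = 1 + (\<Sum>i<N. \<bar>c n3 i / h n3 i\<bar>)"
  have S: "S > 0" by (simp add: S_def add_pos_nonneg sum_nonneg)
  have h0: "0 \<le> h n i" if "i < N" for n i using a0[OF that] b0[OF that] q(1) by (simp add: h_def)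
  have start: "c n3 i \<le> S * h n3 i" if i: "i < N" for i
  proof (cases "h n3 i = 0")
    case True
    have "c n3 i \<le> 0"
    proof (cases "i \<in> V")
      case V: True
      then have "a n3 i = 0" using True q(1) by (simp add: h_def)
      moreover from this have "za i" unfolding za_def by (rule exI)
      ultimately show ?thesis using c_za[OF i, of n3] by simp
    next
      case V: False
      then have "zb i" using True by (auto simp: h_def zb_def)
      then have "c (n2 + (n1 + n2)) i \<le> R * b (n1 + n2) i" using c_zb[OF i V] by blast
      also have "b (n1 + n2) i = 0" using n2(2)[OF _ i \<open>zb i\<close>] by simp
      finally show ?thesis by (simp add: n3_def algebra_simps)
    qed
    then show ?thesis using True by simp
  next
    case False
    have "\<bar>c n3 i / h n3 i\<bar> \<le> (\<Sum>i<N. \<bar>c n3 i / h n3 i\<bar>)"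
      using i by (intro member_le_sum) auto
    then have "c n3 i / h n3 i \<le> S"
      using abs_ge_self[of "c n3 i / h n3 i"] unfolding S_def by linarith
    moreover have "0 < h n3 i" using False h0[OF i, of n3] by simp
    ultimately show ?thesis by (simp add: field_simps)
  qed
  have ch: "c n i \<le> S * h n i" if "n \<ge> n3" "i < N" for n i
    using that
  proof (induction n arbitrary: i rule: dec_induct)
    case base
    then show ?case by (rule start)
  next
    case (step n)
    have "c (Suc n) i \<le> ap C (\<lambda>j. S * h n j) i"
      unfolding c_Suc by (rule mat_app_mono) (use nonneg[OF C(1)] step in auto)
    also have "\<dots> = S * ap C (h n) i" by (rule mat_app_scale)
    also have "\<dots> \<le> S * h (Suc n) i"
      using Ch[of n i] step S by (intro mult_left_mono) (auto simp: n3_def)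
    finally show ?case .
  qed
  have "growth_dom C A"
    unfolding growth_dom_def a_def[symmetric] c_def[symmetric]
  proof (intro exI[of _ "S / q"] conjI eventually_sequentiallyI[of n3] allI impI)
    fix n i assume n: "n3 \<le> n" and i: "i < N"
    have "c n i \<le> S * h n i" by (rule ch) (use n i in auto)
    also have "\<dots> \<le> S * (1 / q * a n i)" using S ha[OF _ i, of n] n by (intro mult_left_mono) (auto simp: n3_def)
    finally show "c n i \<le> S / q * a n i" by simp
  qed (use S q in simp)
  moreover have "growth_dom C B"
    unfolding growth_dom_def b_def[symmetric] c_def[symmetric]
  proof (intro exI[of _ S] conjI eventually_sequentiallyI[of n3] allI impI)
    fix n i assume n: "n3 \<le> n" and i: "i < N"
    have "c n i \<le> S * h n i" by (rule ch) (use n i in auto)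
    also have "\<dots> \<le> S * b n i" using S hb[of n i] n by (intro mult_left_mono) (auto simp: n3_def)
    finally show "c n i \<le> S * b n i" .
  qed (use S in simp)
  ultimately show ?thesis using C(1) by blast
qed

text \<open>Common minorants make the preorder downward directed, and a finite directed preorder has
  a least element.\<close>

lemma growth_least_exists: "\<exists>B\<in>K. \<forall>A\<in>K. growth_dom B A"
proof -
  have "\<exists>B\<in>K. \<forall>A\<in>S. growth_dom B A" if "finite S" "S \<subseteq> K" for S
    using that
  proof (induction S rule: finite_induct)
    case empty
    then show ?case using K_nonempty by auto
  next
    case (insert A S)
    then obtain B where B: "B \<in> K" "\<forall>A\<in>S. growth_dom B A" by auto
    obtain C where C: "C \<in> K" "growth_dom C A" "growth_dom C B"
      using common_growth_minorant[of A B] B insert by auto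
    then show ?case using B growth_dom_trans by (intro bexI[of _ C]) auto
  qed
  from this[OF finite_K order_refl] show ?thesis .
qed

end

section \<open>The equivalences\<close>

lemma growth_le_trans:
  assumes "growth_le a b" "growth_le b c"
  shows "growth_le a c"
proof -
  obtain p q where p: "p > 0" "\<forall>\<^sub>F n in sequentially. a n \<le> p * b n"
    and q: "q > 0" "\<forall>\<^sub>F n in sequentially. b n \<le> q * c n"
    using assms unfolding growth_le_def by auto
  have "\<forall>\<^sub>F n in sequentially. a n \<le> p * q * c n"
    using p(2) q(2)
  proof eventually_elim
    case (elim n)
    have "p * b n \<le> p * (q * c n)" using elim p by (intro mult_left_mono) auto
    then show ?case using elim by simp
  qed
  then show ?thesis unfolding growth_le_def using p(1) q(1) by (intro exI[of _ "p * q"]) auto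
qed

lemma growth_eq_sym: "growth_eq a b \<Longrightarrow> growth_eq b a"
  by (simp add: growth_eq_def)

lemma growth_eq_trans: "growth_eq a b \<Longrightarrow> growth_eq b c \<Longrightarrow> growth_eq a c"
  unfolding growth_eq_def using growth_le_trans by blast

lemma growth_leI:
  assumes "q > 0" "\<And>n. a n \<le> q * b n"
  shows "growth_le a b"
  unfolding growth_le_def using assms by (intro exI[of _ q]) auto

text \<open>For the family \<open>{B}\<close> the minimum map is \<open>B\<close> itself, so results
  about \<open>F\<close> yield positive eigenvectors of a single matrix.\<close>

lemma product_family_singleton:
  assumes "N > 0" "B \<in> carrier_mat N N" "\<And>i j. i < N \<Longrightarrow> j < N \<Longrightarrow> 0 \<le> B $$ (i, j)"
  shows "product_family N {B}"
proof
  have "mat N N (\<lambda>(i, j). if i \<in> V then B $$ (i, j) else B $$ (i, j)) = B" for V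
    by (rule eq_matI) (use assms in auto)
  then show "product_property N {B}" by (simp add: product_property_def)
qed (use assms in auto)

context product_family
begin

section \<open>Transfer between vectors and functions\<close>

lemma F_iter_cong:
  assumes "i < N" "\<And>j. j < N \<Longrightarrow> x j = y j"
  shows "(F ^^ n) x i = (F ^^ n) y i"
  using F_iter_mono[of i x y n] F_iter_mono[of i y x n] assms by (simp add: antisym)

lemma ap_iter_cong:
  assumes "A \<in> K" "i < N" "\<And>j. j < N \<Longrightarrow> x j = y j"
  shows "(ap A ^^ n) x i = (ap A ^^ n) y i"
  using ap_iter_mono[of A i x y n] ap_iter_mono[of A i y x n] assms by (simp add: antisym)

lemma f_min_index:
  assumes "v \<in> carrier_vec N" "i < N"
  shows "f_min N K v $ i = F (($) v) i"
proof -
  have "(\<lambda>A. (A *\<^sub>v v) $ i) ` K = (\<lambda>A. ap A (($) v) i) ` K"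
    by (intro image_cong refl mult_mat_vec_index carrier assms)
  then show ?thesis using assms by (simp add: f_min_def F_def)
qed

lemma f_min_iter_index:
  assumes v: "v \<in> carrier_vec N"
  shows "i < N \<Longrightarrow> ((f_min N K ^^ n) v) $ i = (F ^^ n) (($) v) i"
proof (induction n arbitrary: i)
  case (Suc n)
  have c: "(f_min N K ^^ n) v \<in> carrier_vec N"
    using v by (cases n) (simp_all add: f_min_def)
  have "((f_min N K ^^ Suc n) v) $ i = F (($) ((f_min N K ^^ n) v)) i"
    using f_min_index[OF c Suc.prems] by simp
  also have "\<dots> = F ((F ^^ n) (($) v)) i" by (rule F_cong) (rule Suc.IH)
  finally show ?case by simp
qed simp

lemma pos_f_min_eigenvector_iff:
  "(\<exists>v. pos_vec N v \<and> f_min N K v = \<mu> \<cdot>\<^sub>v v) \<longleftrightarrow> (\<exists>x. (\<forall>i<N. 0 < x i) \<and> (\<forall>i<N. F x i = \<mu> * x i))"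
proof
  assume "\<exists>v. pos_vec N v \<and> f_min N K v = \<mu> \<cdot>\<^sub>v v"
  then obtain v where v: "pos_vec N v" "f_min N K v = \<mu> \<cdot>\<^sub>v v" by blast
  then have c: "v \<in> carrier_vec N" by (simp add: pos_vec_def)
  have "F (($) v) i = \<mu> * v $ i" if "i < N" for i
    using f_min_index[OF c that] v c that by simp
  then show "\<exists>x. (\<forall>i<N. 0 < x i) \<and> (\<forall>i<N. F x i = \<mu> * x i)"
    using v by (intro exI[of _ "($) v"]) (simp add: pos_vec_def)
next
  assume "\<exists>x. (\<forall>i<N. 0 < x i) \<and> (\<forall>i<N. F x i = \<mu> * x i)"
  then obtain x where x: "\<forall>i<N. 0 < x i" "\<forall>i<N. F x i = \<mu> * x i" by blast
  define v where "v = vec N x"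
  have v: "v \<in> carrier_vec N" by (simp add: v_def)
  have "f_min N K v = \<mu> \<cdot>\<^sub>v v"
  proof (rule eq_vecI)
    fix i assume "i < dim_vec (\<mu> \<cdot>\<^sub>v v)"
    then have i: "i < N" by (simp add: v_def)
    have "F (($) v) i = F x i" by (rule F_cong) (simp add: v_def)
    then show "f_min N K v $ i = (\<mu> \<cdot>\<^sub>v v) $ i"
      using f_min_index[OF v i] x i by (simp add: v_def)
  qed (simp add: f_min_def v_def)
  then show "\<exists>v. pos_vec N v \<and> f_min N K v = \<mu> \<cdot>\<^sub>v v"
    using x by (intro exI[of _ v]) (simp add: pos_vec_def v_def)
qed

lemma has_pos_eigenvector_iff:
  assumes B: "B \<in> K"
  shows "has_pos_eigenvector N B \<longleftrightarrow> (\<exists>x \<mu>. (\<forall>i<N. 0 < x i) \<and> (\<forall>i<N. ap B x i = \<mu> * x i))"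
proof
  assume "has_pos_eigenvector N B"
  then obtain v \<mu> where v: "pos_vec N v" "eigenvector B v \<mu>" unfolding has_pos_eigenvector_def by blast
  then have c: "v \<in> carrier_vec N" by (simp add: pos_vec_def)
  have "ap B (($) v) i = \<mu> * v $ i" if "i < N" for i
    using mult_mat_vec_index[OF carrier[OF B] c that] v c that by (simp add: eigenvector_def)
  then show "\<exists>x \<mu>. (\<forall>i<N. 0 < x i) \<and> (\<forall>i<N. ap B x i = \<mu> * x i)"
    using v by (intro exI[of _ "($) v"] exI[of _ \<mu>]) (simp add: pos_vec_def)
next
  assume "\<exists>x \<mu>. (\<forall>i<N. 0 < x i) \<and> (\<forall>i<N. ap B x i = \<mu> * x i)"
  then obtain x \<mu> where x: "\<forall>i<N. 0 < x i" "\<forall>i<N. ap B x i = \<mu> * x i" by blast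
  define v where "v = vec N x"
  have v: "v \<in> carrier_vec N" by (simp add: v_def)
  have pos: "pos_vec N v" using x by (simp add: pos_vec_def v_def)
  have "B *\<^sub>v v = \<mu> \<cdot>\<^sub>v v"
  proof (rule eq_vecI)
    fix i assume "i < dim_vec (\<mu> \<cdot>\<^sub>v v)"
    then have i: "i < N" by (simp add: v_def)
    have "ap B (($) v) i = ap B x i" by (rule mat_app_cong) (simp add: v_def)
    then show "(B *\<^sub>v v) $ i = (\<mu> \<cdot>\<^sub>v v) $ i"
      using mult_mat_vec_index[OF carrier[OF B] v i] x i by (simp add: v_def)
  qed (use carrier[OF B] in \<open>simp add: v_def\<close>)
  moreover have "v \<noteq> 0\<^sub>v N" using pos N_pos unfolding pos_vec_def by (metis index_zero_vec(1) less_irrefl)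
  ultimately have "eigenvector B v \<mu>" using v carrier[OF B] by (simp add: eigenvector_def)
  then show "has_pos_eigenvector N B" using pos unfolding has_pos_eigenvector_def by blast
qed

lemma pow_mult_vec_le_iff:
  assumes "A \<in> K" "B \<in> K" "v \<in> carrier_vec N"
  shows "(B ^\<^sub>m n) *\<^sub>v v \<le> q \<cdot>\<^sub>v ((A ^\<^sub>m n) *\<^sub>v v) \<longleftrightarrow>
    (\<forall>i<N. (ap B ^^ n) (($) v) i \<le> q * (ap A ^^ n) (($) v) i)"
proof -
  have d: "dim_vec ((A ^\<^sub>m n) *\<^sub>v v) = N" "dim_vec ((B ^\<^sub>m n) *\<^sub>v v) = N"
    using carrier_matD(1)[OF pow_carrier_mat[OF carrier[OF assms(1)], of n]]
      carrier_matD(1)[OF pow_carrier_mat[OF carrier[OF assms(2)], of n]]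
    by (simp_all only: dim_mult_mat_vec)
  show ?thesis
    unfolding less_eq_vec_def index_smult_vec(2) d
    using pow_mult_mat_vec_index[OF carrier[OF assms(1)] assms(3), of _ n]
      pow_mult_mat_vec_index[OF carrier[OF assms(2)] assms(3), of _ n] d
    by (auto simp: index_smult_vec(1) simp del: index_mult_mat_vec dim_mult_mat_vec pow_mat_dim)
qed

lemma growth_minimal_iff: "growth_minimal N K B \<longleftrightarrow> B \<in> K \<and> (\<forall>A\<in>K. growth_dom B A)"
proof
  assume B: "growth_minimal N K B"
  then have BK: "B \<in> K" by (simp add: growth_minimal_def)
  have "growth_dom B A" if A: "A \<in> K" for A
  proof -
    define v where "v = vec N (\<lambda>_. 1 :: real)"
    have v: "pos_vec N v" "v \<in> carrier_vec N" by (auto simp: pos_vec_def v_def)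
    obtain q where q: "q > 0" "\<forall>\<^sub>F n in sequentially. (B ^\<^sub>m n) *\<^sub>v v \<le> q \<cdot>\<^sub>v ((A ^\<^sub>m n) *\<^sub>v v)"
      using B A v(1) unfolding growth_minimal_def vec_growth_le_def by blast
    have "(ap D ^^ n) (($) v) i = (ap D ^^ n) (\<lambda>_. 1) i" if "D \<in> K" "i < N" for D n i
      by (rule ap_iter_cong) (use that in \<open>auto simp: v_def\<close>)
    then show ?thesis
      unfolding growth_dom_def using q unfolding pow_mult_vec_le_iff[OF A BK v(2)]
      by (intro exI[of _ q]) (simp add: A BK)
  qed
  then show "B \<in> K \<and> (\<forall>A\<in>K. growth_dom B A)" using BK by blast
next
  assume B: "B \<in> K \<and> (\<forall>A\<in>K. growth_dom B A)"
  then have BK: "B \<in> K" by simp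
  show "growth_minimal N K B"
    unfolding growth_minimal_def
  proof (intro conjI ballI allI impI BK)
    fix A v assume A: "A \<in> K" and v: "pos_vec N v"
    have vc: "v \<in> carrier_vec N" and vp: "\<And>i. i < N \<Longrightarrow> 0 < v $ i" using v by (auto simp: pos_vec_def)
    obtain \<beta> where \<beta>: "\<beta> > 0" "\<forall>i<N. v $ i \<le> \<beta> * 1"
      using pos_functions_comparable[of N "\<lambda>_. 1" "($) v"] by auto
    obtain \<gamma> where \<gamma>: "\<gamma> > 0" "\<forall>i<N. 1 \<le> \<gamma> * v $ i"
      using pos_functions_comparable[of N "($) v" "\<lambda>_. 1"] vp by auto
    obtain q where q: "q > 0" "\<forall>\<^sub>F n in sequentially. \<forall>i<N. (ap B ^^ n) (\<lambda>_. 1) i \<le> q * (ap A ^^ n) (\<lambda>_. 1) i"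
      using B A unfolding growth_dom_def by blast
    have "\<forall>\<^sub>F n in sequentially. (B ^\<^sub>m n) *\<^sub>v v \<le> (\<beta> * (q * \<gamma>)) \<cdot>\<^sub>v ((A ^\<^sub>m n) *\<^sub>v v)"
      using q(2)
    proof eventually_elim
      case (elim n)
      show ?case unfolding pow_mult_vec_le_iff[OF A BK vc]
      proof (intro allI impI)
        fix i assume i: "i < N"
        have "(ap B ^^ n) (($) v) i \<le> (ap B ^^ n) (\<lambda>_. \<beta> * 1) i"
          by (rule ap_iter_mono) (use BK i \<beta> in auto)
        also have "\<dots> = \<beta> * (ap B ^^ n) (\<lambda>_. 1) i" by (rule ap_iter_scale)
        also have "\<dots> \<le> \<beta> * (q * (ap A ^^ n) (\<lambda>_. 1) i)"
          using elim i \<beta> by (intro mult_left_mono) auto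
        also have "\<dots> \<le> \<beta> * (q * (ap A ^^ n) (\<lambda>j. \<gamma> * v $ j) i)"
          using \<beta> q \<gamma> A i by (intro mult_left_mono ap_iter_mono) auto
        also have "(ap A ^^ n) (\<lambda>j. \<gamma> * v $ j) i = \<gamma> * (ap A ^^ n) (($) v) i" by (rule ap_iter_scale)
        finally show "(ap B ^^ n) (($) v) i \<le> \<beta> * (q * \<gamma>) * (ap A ^^ n) (($) v) i"
          by (simp add: mult.assoc)
      qed
    qed
    then show "vec_growth_le (\<lambda>n. (B ^\<^sub>m n) *\<^sub>v v) (\<lambda>n. (A ^\<^sub>m n) *\<^sub>v v)"
      unfolding vec_growth_le_def using \<beta> q \<gamma> by (intro exI[of _ "\<beta> * (q * \<gamma>)"]) auto
  qed
qed

lemma growth_minimal_exists: "\<exists>B. growth_minimal N K B"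
  using growth_least_exists growth_minimal_iff by blast

section \<open>Consequences of and criteria for a positive eigenvector\<close>

lemma F_iter_eigenvector:
  assumes "\<And>i. i < N \<Longrightarrow> F x i = \<mu> * x i" "0 \<le> \<mu>" "i < N"
  shows "(F ^^ n) x i = \<mu> ^ n * x i"
  using assms(3)
proof (induction n arbitrary: i)
  case (Suc n)
  have "F ((F ^^ n) x) i = F (\<lambda>j. \<mu> ^ n * x j) i" by (rule F_cong) (rule Suc.IH)
  also have "\<dots> = \<mu> ^ n * F x i" by (rule F_scale) (use assms in simp)
  finally show ?case using assms Suc.prems by simp
qed simp

lemma ap_iter_eigenvector:
  assumes A: "A \<in> K" and "\<And>i. i < N \<Longrightarrow> ap A x i = \<mu> * x i" "i < N"
  shows "(ap A ^^ n) x i = \<mu> ^ n * x i"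
  using assms(3)
proof (induction n arbitrary: i)
  case (Suc n)
  have "ap A ((ap A ^^ n) x) i = ap A (\<lambda>j. \<mu> ^ n * x j) i" by (rule mat_app_cong) (rule Suc.IH)
  also have "\<dots> = \<mu> ^ n * ap A x i" by (rule mat_app_scale)
  finally show ?case using assms Suc.prems by simp
qed simp

text \<open>The member greedy at \<open>x\<close> has spectral radius \<open>\<mu>\<close>, which
  gives positivity. It is also the upper comparison for every minimal \<open>B\<close>, while
  \<open>F\<close> itself is the lower one.\<close>

lemma pos_eigenvector_consequences:
  assumes rho: "\<And>A. A \<in> K \<Longrightarrow> 0 < real_spectral_radius A"
    and x: "\<And>i. i < N \<Longrightarrow> 0 < x i" and Fx: "\<And>i. i < N \<Longrightarrow> F x i = \<mu> * x i"
  shows "\<mu> > 0" and "minimal_radius N K = \<mu>"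
    and "growth_minimal N K B \<Longrightarrow> has_pos_eigenvector N B"
proof -
  obtain A where A: "A \<in> K" "\<forall>i<N. ap A x i = F x i"
    using greedy_selection[of "\<lambda>_. x"] by blast
  have Ax: "ap A x i = \<mu> * x i" if "i < N" for i using A Fx that by simp
  have "real_spectral_radius A = \<mu>"
    by (rule real_spectral_radius_eq[OF carrier[OF A(1)] N_pos nonneg[OF A(1)] x Ax])
  then show \<mu>: "\<mu> > 0" using rho[OF A(1)] by simp
  obtain \<beta> where \<beta>: "\<beta> > 0" "\<forall>i<N. 1 \<le> \<beta> * x i"
    using pos_functions_comparable[of N x "\<lambda>_. 1"] x by blast
  obtain \<gamma> where \<gamma>: "\<gamma> > 0" "\<forall>i<N. x i \<le> \<gamma> * 1"
    using pos_functions_comparable[of N "\<lambda>_. 1" x] by auto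
  have main: "(\<exists>u. (\<forall>i<N. 0 < u i) \<and> (\<forall>i<N. ap B u i = \<mu> * u i))" if B: "growth_minimal N K B" for B
  proof -
    have BK: "B \<in> K" and "growth_dom B A" using B A(1) growth_minimal_iff by auto
    then obtain q n0 where q: "q > 0"
      "\<And>n i. n \<ge> n0 \<Longrightarrow> i < N \<Longrightarrow> (ap B ^^ n) (\<lambda>_. 1) i \<le> q * (ap A ^^ n) (\<lambda>_. 1) i"
      unfolding growth_dom_def eventually_sequentially by blast
    interpret single: product_family N "{B}"
      by (rule product_family_singleton) (use N_pos carrier[OF BK] nonneg[OF BK] in auto)
    have single_F: "single.F = ap B" by (intro ext) (simp add: single.F_def)
    have lower: "\<mu> ^ n * x i \<le> (ap B ^^ n) x i" if "i < N" for n i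
      using F_iter_le_ap_iter[OF BK that, of n x] F_iter_eigenvector[OF Fx _ that, of n] \<mu> by simp
    have upper: "(ap B ^^ n) x i \<le> \<gamma> * q * \<beta> * \<gamma> * \<mu> ^ n" if "n \<ge> n0" "i < N" for n i
    proof -
      have "(ap B ^^ n) x i \<le> (ap B ^^ n) (\<lambda>_. \<gamma> * 1) i"
        by (rule ap_iter_mono) (use BK that \<gamma> in auto)
      also have "\<dots> = \<gamma> * (ap B ^^ n) (\<lambda>_. 1) i" by (rule ap_iter_scale)
      also have "\<dots> \<le> \<gamma> * (q * (ap A ^^ n) (\<lambda>_. 1) i)"
        using q that \<gamma> by (intro mult_left_mono) auto
      also have "\<dots> \<le> \<gamma> * (q * (ap A ^^ n) (\<lambda>j. \<beta> * x j) i)"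
        using q that \<gamma> \<beta> A by (intro mult_left_mono ap_iter_mono) auto
      also have "(ap A ^^ n) (\<lambda>j. \<beta> * x j) i = \<beta> * (\<mu> ^ n * x i)"
        unfolding ap_iter_scale using ap_iter_eigenvector[OF A(1) Ax that(2)] by simp
      also have "\<gamma> * (q * (\<beta> * (\<mu> ^ n * x i))) = \<gamma> * q * \<beta> * \<mu> ^ n * x i" by simp
      also have "\<dots> \<le> \<gamma> * q * \<beta> * \<mu> ^ n * \<gamma>"
        using q that \<gamma> \<beta> \<mu> by (intro mult_left_mono) auto
      finally show ?thesis by (simp add: mult_ac)
    qed
    \<comment> \<open>The upper bound holds only from \<open>n0\<close> on, so the orbit is started
      at time \<open>n0\<close> and the powers \<open>\<mu> ^ n0\<close> move into the
      constants.\<close>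
    show ?thesis
    proof (rule single.pos_eigenvector_of_bounds[of \<mu> "\<mu> ^ n0 / \<beta>" "(ap B ^^ n0) x" "\<gamma> * q * \<beta> * \<gamma> * \<mu> ^ n0"])
      fix n i assume i: "i < N"
      have sp: "(single.F ^^ n) ((ap B ^^ n0) x) i = (ap B ^^ (n + n0)) x i"
        by (simp add: single_F funpow_add)
      have "\<mu> ^ n0 / \<beta> * \<mu> ^ n \<le> \<mu> ^ (n + n0) * x i"
        using \<beta> i \<mu> by (simp add: power_add field_simps)
      also have "\<dots> \<le> (ap B ^^ (n + n0)) x i" by (rule lower[OF i])
      finally show "\<mu> ^ n0 / \<beta> * \<mu> ^ n \<le> (single.F ^^ n) ((ap B ^^ n0) x) i" by (simp only: sp)
      show "(single.F ^^ n) ((ap B ^^ n0) x) i \<le> \<gamma> * q * \<beta> * \<gamma> * \<mu> ^ n0 * \<mu> ^ n"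
        using upper[of "n + n0" i] i unfolding sp by (simp add: power_add mult_ac)
    next
      fix u assume "\<And>i. i < N \<Longrightarrow> 0 < u i" "\<And>i. i < N \<Longrightarrow> single.F u i = \<mu> * u i"
      then show ?thesis unfolding single_F by blast
    qed (use \<mu> \<beta> in auto)
  qed
  show "growth_minimal N K B \<Longrightarrow> has_pos_eigenvector N B"
    using main[of B] has_pos_eigenvector_iff[of B] growth_minimal_iff[of B] by blast
  have radius: "real_spectral_radius B = \<mu>" if B: "growth_minimal N K B" for B
  proof -
    have BK: "B \<in> K" using B growth_minimal_iff by blast
    obtain u where u: "\<forall>i<N. 0 < u i" "\<forall>i<N. ap B u i = \<mu> * u i" using main[OF B] by blast
    show ?thesis
      by (rule real_spectral_radius_eq[OF carrier[OF BK] N_pos nonneg[OF BK], of u]) (use u in auto)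
  qed
  \<comment> \<open>The definite description needs a witness besides uniqueness of the radius; this
    is where existence of a minimal matrix enters.\<close>
  obtain B0 where B0: "growth_minimal N K B0" using growth_minimal_exists by blast
  show "minimal_radius N K = \<mu>"
    unfolding minimal_radius_def
  proof (rule the_equality)
    show "\<exists>B. growth_minimal N K B \<and> \<mu> = real_spectral_radius B" using B0 radius by blast
    show "r = \<mu>" if "\<exists>B. growth_minimal N K B \<and> r = real_spectral_radius B" for r
      using that radius by blast
  qed
qed

lemma growth_of_pos_eigenvector:
  assumes x: "\<And>i. i < N \<Longrightarrow> 0 < x i" and Fx: "\<And>i. i < N \<Longrightarrow> F x i = \<mu> * x i"
    and \<mu>: "\<mu> > 0" and v: "\<And>i. i < N \<Longrightarrow> 0 < v i" and i: "i < N"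
  shows "growth_eq (\<lambda>n. (F ^^ n) v i) (\<lambda>n. \<mu> ^ n)"
proof -
  have iter: "(F ^^ n) x i = \<mu> ^ n * x i" for n
    by (rule F_iter_eigenvector[OF Fx less_imp_le[OF \<mu>] i])
  obtain \<beta> where \<beta>: "\<beta> > 0" "\<forall>i<N. v i \<le> \<beta> * x i"
    using pos_functions_comparable[of N x v] x by blast
  obtain \<gamma> where \<gamma>: "\<gamma> > 0" "\<forall>i<N. x i \<le> \<gamma> * v i"
    using pos_functions_comparable[of N v x] v by blast
  have "(F ^^ n) v i \<le> \<beta> * x i * \<mu> ^ n" for n
  proof -
    have "(F ^^ n) v i \<le> (F ^^ n) (\<lambda>j. \<beta> * x j) i" by (rule F_iter_mono) (use i \<beta> in auto)
    also have "\<dots> = \<beta> * (\<mu> ^ n * x i)" using \<beta> by (simp add: F_iter_scale iter)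
    finally show ?thesis by (simp add: mult_ac)
  qed
  moreover have "\<mu> ^ n \<le> \<gamma> / x i * (F ^^ n) v i" for n
  proof -
    have "\<mu> ^ n * x i \<le> (F ^^ n) (\<lambda>j. \<gamma> * v j) i"
      unfolding iter[symmetric] by (rule F_iter_mono) (use i \<gamma> in auto)
    also have "\<dots> = \<gamma> * (F ^^ n) v i" using \<gamma> by (simp add: F_iter_scale)
    finally show ?thesis using x[OF i] by (simp add: field_simps)
  qed
  ultimately show ?thesis
    unfolding growth_eq_def using \<beta> \<gamma> x[OF i]
    by (intro conjI growth_leI[of "\<beta> * x i"] growth_leI[of "\<gamma> / x i"]) auto
qed

lemma pos_eigenvector_of_balanced:
  assumes rho: "\<And>A. A \<in> K \<Longrightarrow> 0 < real_spectral_radius A"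
    and v: "\<And>i. i < N \<Longrightarrow> 0 < v i"
    and bal: "\<And>i j. i < N \<Longrightarrow> j < N \<Longrightarrow> growth_eq (\<lambda>n. (F ^^ n) v i) (\<lambda>n. (F ^^ n) v j)"
  shows "\<exists>x \<mu>. (\<forall>i<N. 0 < x i) \<and> (\<forall>i<N. F x i = \<mu> * x i)"
proof -
  let ?o = "\<lambda>_. 1 :: real"
  obtain \<beta> where \<beta>: "\<beta> > 0" "\<forall>i<N. v i \<le> \<beta> * 1"
    using pos_functions_comparable[of N ?o v] by auto
  obtain \<gamma> where \<gamma>: "\<gamma> > 0" "\<forall>i<N. 1 \<le> \<gamma> * v i"
    using pos_functions_comparable[of N v ?o] v by auto
  have "\<exists>q. \<forall>\<^sub>F n in sequentially. (F ^^ n) ?o i \<le> q * (F ^^ n) ?o j" if ij: "i < N" "j < N" for i j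
  proof -
    obtain q where q: "q > 0" "\<forall>\<^sub>F n in sequentially. (F ^^ n) v i \<le> q * (F ^^ n) v j"
      using bal[OF ij] unfolding growth_eq_def growth_le_def by blast
    have "\<forall>\<^sub>F n in sequentially. (F ^^ n) ?o i \<le> \<gamma> * (q * \<beta>) * (F ^^ n) ?o j"
      using q(2)
    proof eventually_elim
      case (elim n)
      have "(F ^^ n) ?o i \<le> (F ^^ n) (\<lambda>j. \<gamma> * v j) i" by (rule F_iter_mono) (use ij \<gamma> in auto)
      also have "\<dots> = \<gamma> * (F ^^ n) v i" using \<gamma> by (simp add: F_iter_scale)
      also have "\<dots> \<le> \<gamma> * (q * (F ^^ n) v j)" using elim \<gamma> by (intro mult_left_mono) auto
      also have "\<dots> \<le> \<gamma> * (q * (F ^^ n) (\<lambda>_. \<beta> * 1) j)"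
        using \<gamma> q \<beta> ij by (intro mult_left_mono F_iter_mono) auto
      also have "(F ^^ n) (\<lambda>_. \<beta> * 1) j = \<beta> * (F ^^ n) ?o j" by (rule F_iter_scale) (use \<beta> in simp)
      finally show ?case by (simp add: mult.assoc)
    qed
    then show ?thesis by (intro exI)
  qed
  from bounds_of_balanced[OF rho this]
  obtain r c C where r: "r > 0" "c > 0" and ev: "\<forall>\<^sub>F n in sequentially. \<forall>i<N.
     c * r ^ n \<le> (F ^^ n) ?o i \<and> (F ^^ n) ?o i \<le> C * r ^ n" by blast
  then obtain n0 where n0: "\<And>n. n \<ge> n0 \<Longrightarrow> \<forall>i<N. c * r ^ n \<le> (F ^^ n) ?o i \<and> (F ^^ n) ?o i \<le> C * r ^ n"
    unfolding eventually_sequentially by blast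
  show ?thesis
  proof (rule pos_eigenvector_of_bounds[of r "c * r ^ n0" "(F ^^ n0) ?o" "C * r ^ n0"])
    fix n i assume i: "i < N"
    have sp: "(F ^^ n) ((F ^^ n0) ?o) i = (F ^^ (n + n0)) ?o i" by (simp add: funpow_add)
    show "c * r ^ n0 * r ^ n \<le> (F ^^ n) ((F ^^ n0) ?o) i"
      and "(F ^^ n) ((F ^^ n0) ?o) i \<le> C * r ^ n0 * r ^ n"
      using n0[of "n + n0"] i unfolding sp by (simp_all add: power_add mult_ac)
  next
    fix u assume "\<And>i. i < N \<Longrightarrow> 0 < u i" "\<And>i. i < N \<Longrightarrow> F u i = r * u i"
    then show ?thesis by blast
  qed (use r in auto)
qed

text \<open>An eigenvector \<open>v\<close> of a member \<open>B\<close> is a supersolution for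
  \<open>F\<close>, and minimality turns the orbit \<open>r^n v\<close> of \<open>B\<close> into a
  lower bound for the orbit of each member. These are the hypotheses of
  \<open>pos_eigenvector_of_dominated\<close>.\<close>

lemma pos_eigenvector_of_minimal:
  assumes rho: "\<And>A. A \<in> K \<Longrightarrow> 0 < real_spectral_radius A"
    and B: "growth_minimal N K B" "has_pos_eigenvector N B"
  shows "\<exists>x \<mu>. (\<forall>i<N. 0 < x i) \<and> (\<forall>i<N. F x i = \<mu> * x i)"
proof -
  have BK: "B \<in> K" and dom: "\<And>A. A \<in> K \<Longrightarrow> growth_dom B A" using B growth_minimal_iff by auto
  obtain v r where v: "\<And>i. i < N \<Longrightarrow> 0 < v i" and Bv: "\<And>i. i < N \<Longrightarrow> ap B v i = r * v i"
    using B(2) has_pos_eigenvector_iff[OF BK] by auto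
  have "real_spectral_radius B = r"
    by (rule real_spectral_radius_eq[OF carrier[OF BK] N_pos nonneg[OF BK] v Bv])
  then have r: "r > 0" using rho[OF BK] by simp
  obtain \<beta> where \<beta>: "\<beta> > 0" "\<forall>i<N. v i \<le> \<beta> * 1"
    using pos_functions_comparable[of N "\<lambda>_. 1" v] by auto
  obtain \<gamma> where \<gamma>: "\<gamma> > 0" "\<forall>i<N. 1 \<le> \<gamma> * v i"
    using pos_functions_comparable[of N v "\<lambda>_. 1"] v by auto
  show ?thesis
  proof (rule pos_eigenvector_of_dominated[of r v])
    show "F v i \<le> r * v i" if "i < N" for i using F_le[OF BK, of v i] Bv[OF that] by simp
    fix A assume A: "A \<in> K"
    obtain q where q: "q > 0" "\<forall>\<^sub>F n in sequentially. \<forall>i<N. (ap B ^^ n) (\<lambda>_. 1) i \<le> q * (ap A ^^ n) (\<lambda>_. 1) i"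
      using dom[OF A] unfolding growth_dom_def by blast
    have "\<forall>\<^sub>F n in sequentially. \<forall>i<N. 1 / (\<gamma> * \<beta> * q * \<gamma>) * r ^ n \<le> (ap A ^^ n) v i"
      using q(2)
    proof eventually_elim
      case (elim n)
      show ?case
      proof (intro allI impI)
        fix i assume i: "i < N"
        have "r ^ n * 1 \<le> r ^ n * (\<gamma> * v i)" using \<gamma> i r by (intro mult_left_mono) auto
        also have "\<dots> = \<gamma> * (ap B ^^ n) v i" using ap_iter_eigenvector[OF BK Bv i] by simp
        also have "\<dots> \<le> \<gamma> * (ap B ^^ n) (\<lambda>_. \<beta> * 1) i"
          using \<gamma> \<beta> i BK by (intro mult_left_mono ap_iter_mono) auto
        also have "(ap B ^^ n) (\<lambda>_. \<beta> * 1) i = \<beta> * (ap B ^^ n) (\<lambda>_. 1) i" by (rule ap_iter_scale)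
        also have "\<gamma> * (\<beta> * (ap B ^^ n) (\<lambda>_. 1) i) \<le> \<gamma> * (\<beta> * (q * (ap A ^^ n) (\<lambda>_. 1) i))"
          using elim i \<gamma> \<beta> by (intro mult_left_mono) auto
        also have "\<dots> \<le> \<gamma> * (\<beta> * (q * (ap A ^^ n) (\<lambda>j. \<gamma> * v j) i))"
          using \<gamma> \<beta> q i A by (intro mult_left_mono ap_iter_mono) auto
        also have "(ap A ^^ n) (\<lambda>j. \<gamma> * v j) i = \<gamma> * (ap A ^^ n) v i" by (rule ap_iter_scale)
        finally have "r ^ n \<le> (\<gamma> * \<beta> * q * \<gamma>) * (ap A ^^ n) v i" by (simp add: mult.assoc)
        then show "1 / (\<gamma> * \<beta> * q * \<gamma>) * r ^ n \<le> (ap A ^^ n) v i"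
          using \<gamma> \<beta> q by (simp add: pos_divide_le_eq mult.commute)
      qed
    qed
    moreover have "1 / (\<gamma> * \<beta> * q * \<gamma>) > 0" using \<gamma> \<beta> q by simp
    ultimately show "\<exists>c>0. \<forall>\<^sub>F n in sequentially. \<forall>i<N. c * r ^ n \<le> (ap A ^^ n) v i" by blast
  next
    fix u assume "\<And>i. i < N \<Longrightarrow> 0 < u i" "\<And>i. i < N \<Longrightarrow> F u i = r * u i"
    then show ?thesis by blast
  qed (use r v in auto)
qed

end

theorem corollary12:
  fixes N :: nat and K :: "real mat set" and a b_some b_every c_some c_every d_some d_every :: bool
  assumes "N > 0"
    and "finite K" and "K \<noteq> {}"
    and "K \<subseteq> carrier_mat N N"
    and "\<forall>A\<in>K. 0\<^sub>m N N \<le> A"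
    and "product_property N K"
    and "\<forall>A\<in>K. 0 < real_spectral_radius A"
  defines "a \<equiv> \<exists>v \<mu>. pos_vec N v \<and> f_min N K v = \<mu> \<cdot>\<^sub>v v"
    and "b_some \<equiv> \<exists>B. growth_minimal N K B \<and> has_pos_eigenvector N B"
    and "b_every \<equiv> \<forall>B. growth_minimal N K B \<longrightarrow> has_pos_eigenvector N B"
    and "c_some \<equiv> \<exists>v. pos_vec N v \<and>
           (\<forall>i<N. growth_eq (\<lambda>n. ((f_min N K ^^ n) v) $ i) (\<lambda>n. minimal_radius N K ^ n))"
    and "c_every \<equiv> \<forall>v. pos_vec N v \<longrightarrow>
           (\<forall>i<N. growth_eq (\<lambda>n. ((f_min N K ^^ n) v) $ i) (\<lambda>n. minimal_radius N K ^ n))"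
    and "d_some \<equiv> \<exists>v. pos_vec N v \<and>
           (\<forall>i<N. \<forall>j<N. growth_eq (\<lambda>n. ((f_min N K ^^ n) v) $ i) (\<lambda>n. ((f_min N K ^^ n) v) $ j))"
    and "d_every \<equiv> \<forall>v. pos_vec N v \<longrightarrow>
           (\<forall>i<N. \<forall>j<N. growth_eq (\<lambda>n. ((f_min N K ^^ n) v) $ i) (\<lambda>n. ((f_min N K ^^ n) v) $ j))"
  shows "(a \<longleftrightarrow> b_some) \<and> (a \<longleftrightarrow> b_every) \<and>
         (a \<longleftrightarrow> c_some) \<and> (a \<longleftrightarrow> c_every) \<and>
         (a \<longleftrightarrow> d_some) \<and> (a \<longleftrightarrow> d_every)"
proof -
  interpret product_family N K
  proof
    fix A i j assume "A \<in> K" "i < N" "j < N"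
    then show "0 \<le> A $$ (i, j)" using assms(4,5) by (force simp: less_eq_mat_def)
  qed (use assms(1-6) in auto)
  have rho: "0 < real_spectral_radius A" if "A \<in> K" for A using assms(7) that by blast
  have a_iff: "a \<longleftrightarrow> (\<exists>x \<mu>. (\<forall>i<N. 0 < x i) \<and> (\<forall>i<N. F x i = \<mu> * x i))"
    unfolding a_def using pos_f_min_eigenvector_iff by blast
  \<comment> \<open>A strictly positive vector exists, so the conditions on every such vector imply
    those on some.\<close>
  have ones: "pos_vec N (vec N (\<lambda>_. 1))" by (simp add: pos_vec_def)
  have a_b: b_every and a_c: c_every if a
  proof -
    obtain x \<mu> where x: "\<And>i. i < N \<Longrightarrow> 0 < x i" and Fx: "\<And>i. i < N \<Longrightarrow> F x i = \<mu> * x i"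
      using \<open>a\<close> a_iff by auto
    note cons = pos_eigenvector_consequences[OF rho x Fx]
    show b_every unfolding b_every_def using cons(3) by blast
    show c_every unfolding c_every_def
    proof (intro allI impI)
      fix v i assume v: "pos_vec N v" and i: "i < N"
      have "growth_eq (\<lambda>n. (F ^^ n) (($) v) i) (\<lambda>n. \<mu> ^ n)"
        by (rule growth_of_pos_eigenvector[OF x Fx cons(1) _ i]) (use v in \<open>auto simp: pos_vec_def\<close>)
      then show "growth_eq (\<lambda>n. ((f_min N K ^^ n) v) $ i) (\<lambda>n. minimal_radius N K ^ n)"
        using v i by (simp add: f_min_iter_index pos_vec_def cons(2))
    qed
  qed
  \<comment> \<open>All paths return to \<open>a\<close> through \<open>b_some\<close> or
    \<open>d_some\<close>; the conditions c) reach \<open>d_some\<close> because components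
    comparable to the same sequence are comparable to each other.\<close>
  have "b_every \<Longrightarrow> b_some" unfolding b_every_def b_some_def using growth_minimal_exists by blast
  moreover have "b_some \<Longrightarrow> a"
    unfolding b_some_def a_iff using pos_eigenvector_of_minimal[OF rho] by blast
  moreover have "c_every \<Longrightarrow> c_some" unfolding c_every_def c_some_def using ones by blast
  moreover have "c_every \<Longrightarrow> d_every"
    unfolding c_every_def d_every_def by (meson growth_eq_sym growth_eq_trans)
  moreover have "c_some \<Longrightarrow> d_some"
    unfolding c_some_def d_some_def by (meson growth_eq_sym growth_eq_trans)
  moreover have "d_every \<Longrightarrow> d_some" unfolding d_every_def d_some_def using ones by blast
  moreover have a if d_some
  proof -
    obtain v where v: "pos_vec N v" and bal: "\<forall>i<N. \<forall>j<N.
        growth_eq (\<lambda>n. ((f_min N K ^^ n) v) $ i) (\<lambda>n. ((f_min N K ^^ n) v) $ j)"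
      using \<open>d_some\<close> unfolding d_some_def by blast
    have c: "v \<in> carrier_vec N" using v by (simp add: pos_vec_def)
    show a unfolding a_iff
      by (rule pos_eigenvector_of_balanced[OF rho, of "($) v"])
        (use v bal in \<open>auto simp: pos_vec_def f_min_iter_index[OF c]\<close>)
  qed
  ultimately show ?thesis using a_b a_c by blast
qed

end
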